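(* Let $k$ be a commutative ring, let $(H,K,\langle-,-\rangle)$ be a pairing of Hopf algebras over $k$, and let $(C,A,\langle-,-\rangle)$ be a pairing between a coalgebra $C$ and an algebra $A$. Consider a morphism of pairings $(\omega,\pi):(C,A,\langle-,-\rangle)\to(H,K,\langle-,-\rangle)$. (1) If the pairing $(C,A,\langle-,-\rangle)$ is right non-degenerate and $\omega$ is a partial corepresentation, then $\pi$ is a partial representation. (2) If $k$ is a field, the pairing $(H,K,\langle-,-\rangle)$ is left non-degenerate and $\pi$ is a partial representation, then $\omega$ is a partial corepresentation.
   Context: A pairing $(V,\hat V,\langle-,-\rangle)$ consists of $k$-modules $V,\hat V$ and a linear map $\langle-,-\rangle:V\otimes\hat V\to k$. It is left non-degenerate if $\langle v,\hat v\rangle=0$ for all $\hat v$ implies $v=0$; right non-degenerate if $\langle v,\hat v\rangle=0$ for all $v$ implies $\hat v=0$. A morphism of pairings $(V,\hat V)\to(W,\hat W)$ is a couple of linear maps $(f:V\to W,\ g:\hat W\to\hat V)$ with $\langle v,g(\hat w)\rangle=\langle f(v),\hat w\rangle$ for all $v\in V,\hat w\in\hat W$. Thus $\omega:C\to H$ and $\pi:K\to A$. A pairing between a coalgebra $C$ and an algebra $A$ is one satisfying $\langle c,1_A\rangle=\epsilon_C(c)$ and $\langle c,ab\rangle=\langle c_{(1)},a\rangle\langle c_{(2)},b\rangle$. A pairing of Hopf algebras is one compatible with all Hopf algebra structure maps: $\langle h,ab\rangle=\langle h_{(1)},a\rangle\langle h_{(2)},b\rangle$, $\langle hg,a\rangle=\langle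 h,a_{(1)}\rangle\langle g,a_{(2)}\rangle$, $\langle h,1_K\rangle=\epsilon_H(h)$, $\langle 1_H,a\rangle=\epsilon_K(a)$, $\langle S(h),a\rangle=\langle h,S(a)\rangle$. A partial representation of $K$ in a unital algebra $A$ is a linear map $\pi:K\to A$ such that for all $h,l\in K$: $\pi(1_K)=1_A$; $\pi(h)\pi(l_{(1)})\pi(S(l_{(2)}))=\pi(hl_{(1)})\pi(S(l_{(2)}))$; $\pi(h_{(1)})\pi(S(h_{(2)}))\pi(l)=\pi(h_{(1)})\pi(S(h_{(2)})l)$. A partial corepresentation of $H$ over $C$ is a linear map $\omega:C\to H$ with, for all $c\in C$: $\epsilon_H(\omega(c))=\epsilon_C(c)$; $\omega(c_{(1)})_{(1)}\otimes\omega(c_{(1)})_{(2)}S(\omega(c_{(2)}))=\omega(c_{(1)})\otimes\omega(c_{(2)})S(\omega(c_{(3)}))$; $\omega(c_{(1)})S(\omega(c_{(2)})_{(1)})\otimes\omega(c_{(2)})_{(2)}=\omega(c_{(1)})S(\omega(c_{(2)}))\otimes\omega(c_{(3)})$. *)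

theory Defs
  imports "HOL-Algebra.Module" "HOL-Algebra.AbelCoset"
begin

section \<open>Linear maps and tensor products of modules over a commutative ring\<close>

definition linear_map ::
  "('k, 'r) ring_scheme \<Rightarrow> ('k, 'm, 'x) module_scheme \<Rightarrow> ('k, 'n, 'y) module_scheme \<Rightarrow> ('m \<Rightarrow> 'n) \<Rightarrow> bool"
  where "linear_map R M N f \<longleftrightarrow>
    f \<in> carrier M \<rightarrow> carrier N \<and>
    (\<forall>x\<in>carrier M. \<forall>y\<in>carrier M. f (x \<oplus>\<^bsub>M\<^esub> y) = f x \<oplus>\<^bsub>N\<^esub> f y) \<and>
    (\<forall>r\<in>carrier R. \<forall>x\<in>carrier M. f (r \<odot>\<^bsub>M\<^esub> x) = r \<odot>\<^bsub>N\<^esub> f x)"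

definition base_module :: "('k, 'r) ring_scheme \<Rightarrow> ('k, 'k) module"
  where "base_module R =
    \<lparr>carrier = carrier R, mult = (\<otimes>\<^bsub>R\<^esub>), one = \<one>\<^bsub>R\<^esub>, zero = \<zero>\<^bsub>R\<^esub>, add = (\<oplus>\<^bsub>R\<^esub>), smult = (\<otimes>\<^bsub>R\<^esub>)\<rparr>"

text \<open>As in \<^theory>\<open>HOL-Algebra.Module\<close>, the multiplicative fields of a record that is used only as
  a module play no role; below they are left \<^const>\<open>undefined\<close>.\<close>

definition free_module :: "('k, 'r) ring_scheme \<Rightarrow> 'i set \<Rightarrow> ('k, 'i \<Rightarrow> 'k) module"
  where "free_module R I =
    \<lparr>carrier = {f. finite {i. f i \<noteq> \<zero>\<^bsub>R\<^esub>} \<and> {i. f i \<noteq> \<zero>\<^bsub>R\<^esub>} \<subseteq> I \<and> range f \<subseteq> carrier R},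
     mult = undefined, one = undefined,
     zero = (\<lambda>_. \<zero>\<^bsub>R\<^esub>), add = (\<lambda>f g i. f i \<oplus>\<^bsub>R\<^esub> g i), smult = (\<lambda>r f i. r \<otimes>\<^bsub>R\<^esub> f i)\<rparr>"

definition free_gen :: "('k, 'r) ring_scheme \<Rightarrow> 'i \<Rightarrow> 'i \<Rightarrow> 'k"
  where "free_gen R i = (\<lambda>j. if j = i then \<one>\<^bsub>R\<^esub> else \<zero>\<^bsub>R\<^esub>)"

definition submodule_span ::
  "('k, 'r) ring_scheme \<Rightarrow> ('k, 'm, 'x) module_scheme \<Rightarrow> 'm set \<Rightarrow> 'm set"
  where "submodule_span R M X = \<Inter>{N. submodule N R M \<and> X \<subseteq> N}"

definition quotient_module ::
  "('k, 'm, 'x) module_scheme \<Rightarrow> 'm set \<Rightarrow> ('k, 'm set) module"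
  where "quotient_module M N =
    \<lparr>carrier = a_rcosets\<^bsub>M\<^esub> N, mult = undefined, one = undefined,
     zero = N, add = set_add M, smult = (\<lambda>r X. \<Union>x\<in>X. N +>\<^bsub>M\<^esub> (r \<odot>\<^bsub>M\<^esub> x))\<rparr>"

definition tensor_relators ::
  "('k, 'r) ring_scheme \<Rightarrow> ('k, 'm, 'x) module_scheme \<Rightarrow> ('k, 'n, 'y) module_scheme \<Rightarrow> ('m \<times> 'n \<Rightarrow> 'k) set"
  where "tensor_relators R M N = (let F = free_module R (carrier M \<times> carrier N); e = free_gen R in
      {e (x \<oplus>\<^bsub>M\<^esub> x', y) \<ominus>\<^bsub>F\<^esub> (e (x, y) \<oplus>\<^bsub>F\<^esub> e (x', y)) | x x' y.
          x \<in> carrier M \<and> x' \<in> carrier M \<and> y \<in> carrier N}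
    \<union> {e (x, y \<oplus>\<^bsub>N\<^esub> y') \<ominus>\<^bsub>F\<^esub> (e (x, y) \<oplus>\<^bsub>F\<^esub> e (x, y')) | x y y'.
          x \<in> carrier M \<and> y \<in> carrier N \<and> y' \<in> carrier N}
    \<union> {e (r \<odot>\<^bsub>M\<^esub> x, y) \<ominus>\<^bsub>F\<^esub> r \<odot>\<^bsub>F\<^esub> e (x, y) | r x y.
          r \<in> carrier R \<and> x \<in> carrier M \<and> y \<in> carrier N}
    \<union> {e (x, r \<odot>\<^bsub>N\<^esub> y) \<ominus>\<^bsub>F\<^esub> r \<odot>\<^bsub>F\<^esub> e (x, y) | r x y.
          r \<in> carrier R \<and> x \<in> carrier M \<and> y \<in> carrier N})"

definition tensor_null ::
  "('k, 'r) ring_scheme \<Rightarrow> ('k, 'm, 'x) module_scheme \<Rightarrow> ('k, 'n, 'y) module_scheme \<Rightarrow> ('m \<times> 'n \<Rightarrow> 'k) set"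
  where "tensor_null R M N =
    submodule_span R (free_module R (carrier M \<times> carrier N)) (tensor_relators R M N)"

definition tensor ::
  "('k, 'r) ring_scheme \<Rightarrow> ('k, 'm, 'x) module_scheme \<Rightarrow> ('k, 'n, 'y) module_scheme
    \<Rightarrow> ('k, ('m \<times> 'n \<Rightarrow> 'k) set) module"
  where "tensor R M N =
    quotient_module (free_module R (carrier M \<times> carrier N)) (tensor_null R M N)"

definition pure_tensor ::
  "('k, 'r) ring_scheme \<Rightarrow> ('k, 'm, 'x) module_scheme \<Rightarrow> ('k, 'n, 'y) module_scheme
    \<Rightarrow> 'm \<Rightarrow> 'n \<Rightarrow> ('m \<times> 'n \<Rightarrow> 'k) set"
  where "pure_tensor R M N x y =
    tensor_null R M N +>\<^bsub>free_module R (carrier M \<times> carrier N)\<^esub> free_gen R (x, y)"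

text \<open>The linear map \<open>M \<otimes> N \<rightarrow> P\<close> induced by a bilinear map \<open>B\<close>, evaluated on a representative of the
  coset \<open>t\<close>. The value is independent of the representative when \<open>B\<close> is bilinear, which is the only
  case in which it is used.\<close>

definition tensor_lift ::
  "('k, 'r) ring_scheme \<Rightarrow> ('k, 'm, 'x) module_scheme \<Rightarrow> ('k, 'n, 'y) module_scheme
    \<Rightarrow> ('k, 'p, 'z) module_scheme \<Rightarrow> ('m \<Rightarrow> 'n \<Rightarrow> 'p) \<Rightarrow> ('m \<times> 'n \<Rightarrow> 'k) set \<Rightarrow> 'p"
  where "tensor_lift R M N P B t =
    (let f = (SOME f. f \<in> t) in
      \<Oplus>\<^bsub>P\<^esub>p\<in>{p. f p \<noteq> \<zero>\<^bsub>R\<^esub>}. f p \<odot>\<^bsub>P\<^esub> B (fst p) (snd p))"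

section \<open>Algebras, coalgebras and Hopf algebras\<close>

text \<open>The locale \<^locale>\<open>algebra\<close> of the library covers commutative algebras only.\<close>

locale assoc_algebra = module R A + ring A
  for R :: "('k, 'r) ring_scheme" (structure) and A :: "('k, 'a, 'x) module_scheme" (structure) +
  assumes smult_mult_left:
    "\<lbrakk>r \<in> carrier R; x \<in> carrier A; y \<in> carrier A\<rbrakk> \<Longrightarrow>
      (r \<odot>\<^bsub>A\<^esub> x) \<otimes>\<^bsub>A\<^esub> y = r \<odot>\<^bsub>A\<^esub> (x \<otimes>\<^bsub>A\<^esub> y)"
  and smult_mult_right:
    "\<lbrakk>r \<in> carrier R; x \<in> carrier A; y \<in> carrier A\<rbrakk> \<Longrightarrow>
      x \<otimes>\<^bsub>A\<^esub> (r \<odot>\<^bsub>A\<^esub> y) = r \<odot>\<^bsub>A\<^esub> (x \<otimes>\<^bsub>A\<^esub> y)"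

record ('k, 'c) coalg = "('k, 'c) module" +
  comult :: "'c \<Rightarrow> ('c \<times> 'c \<Rightarrow> 'k) set"
  counit :: "'c \<Rightarrow> 'k"

record ('k, 'h) hopf = "('k, 'h) coalg" +
  antipode :: "'h \<Rightarrow> 'h"

text \<open>Sweedler notation: \<open>sweedler R C P (\<lambda>x y. B x y) c\<close> is \<open>B(c\<^sub>1, c\<^sub>2)\<close>, and
  \<open>sweedler3 R C P (\<lambda>x y z. T x y z) c\<close> is \<open>T(c\<^sub>1, c\<^sub>2, c\<^sub>3)\<close>, with values in the module \<open>P\<close>;
  the latter splits the second leg, which by coassociativity is no restriction.\<close>

definition sweedler ::
  "('k, 'r) ring_scheme \<Rightarrow> ('k, 'c, 'x) coalg_scheme \<Rightarrow> ('k, 'p, 'z) module_scheme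
    \<Rightarrow> ('c \<Rightarrow> 'c \<Rightarrow> 'p) \<Rightarrow> 'c \<Rightarrow> 'p"
  where "sweedler R C P B c = tensor_lift R C C P B (comult C c)"

definition sweedler3 ::
  "('k, 'r) ring_scheme \<Rightarrow> ('k, 'c, 'x) coalg_scheme \<Rightarrow> ('k, 'p, 'z) module_scheme
    \<Rightarrow> ('c \<Rightarrow> 'c \<Rightarrow> 'c \<Rightarrow> 'p) \<Rightarrow> 'c \<Rightarrow> 'p"
  where "sweedler3 R C P T c =
    sweedler R C P (\<lambda>x w. sweedler R C P (\<lambda>y z. T x y z) w) c"

locale coalgebra = module R C
  for R :: "('k, 'r) ring_scheme" (structure) and C :: "('k, 'c, 'x) coalg_scheme" (structure) +
  assumes comult_linear: "linear_map R C (tensor R C C) (comult C)"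
  and counit_linear: "linear_map R C (base_module R) (counit C)"
  and coassoc: "c \<in> carrier C \<Longrightarrow>
    sweedler R C (tensor R C (tensor R C C))
      (\<lambda>w z. sweedler R C (tensor R C (tensor R C C))
        (\<lambda>x y. pure_tensor R C (tensor R C C) x (pure_tensor R C C y z)) w) c =
    sweedler R C (tensor R C (tensor R C C))
      (\<lambda>x w. sweedler R C (tensor R C (tensor R C C))
        (\<lambda>y z. pure_tensor R C (tensor R C C) x (pure_tensor R C C y z)) w) c"
  and counit_left: "c \<in> carrier C \<Longrightarrow> sweedler R C C (\<lambda>x y. counit C x \<odot>\<^bsub>C\<^esub> y) c = c"
  and counit_right: "c \<in> carrier C \<Longrightarrow> sweedler R C C (\<lambda>x y. counit C y \<odot>\<^bsub>C\<^esub> x) c = c"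

locale bialgebra = assoc_algebra R H + coalgebra R H
  for R :: "('k, 'r) ring_scheme" (structure) and H :: "('k, 'h, 'x) coalg_scheme" (structure) +
  assumes comult_mult: "\<lbrakk>g \<in> carrier H; h \<in> carrier H\<rbrakk> \<Longrightarrow>
    comult H (g \<otimes>\<^bsub>H\<^esub> h) =
      sweedler R H (tensor R H H)
        (\<lambda>g1 g2. sweedler R H (tensor R H H)
          (\<lambda>h1 h2. pure_tensor R H H (g1 \<otimes>\<^bsub>H\<^esub> h1) (g2 \<otimes>\<^bsub>H\<^esub> h2)) h) g"
  and comult_one: "comult H \<one>\<^bsub>H\<^esub> = pure_tensor R H H \<one>\<^bsub>H\<^esub> \<one>\<^bsub>H\<^esub>"
  and counit_mult: "\<lbrakk>g \<in> carrier H; h \<in> carrier H\<rbrakk> \<Longrightarrow>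
    counit H (g \<otimes>\<^bsub>H\<^esub> h) = counit H g \<otimes>\<^bsub>R\<^esub> counit H h"
  and counit_one: "counit H \<one>\<^bsub>H\<^esub> = \<one>\<^bsub>R\<^esub>"

locale hopf_algebra = bialgebra R H
  for R :: "('k, 'r) ring_scheme" (structure) and H :: "('k, 'h, 'x) hopf_scheme" (structure) +
  assumes antipode_linear: "linear_map R H H (antipode H)"
  and antipode_left: "h \<in> carrier H \<Longrightarrow>
    sweedler R H H (\<lambda>x y. antipode H x \<otimes>\<^bsub>H\<^esub> y) h = counit H h \<odot>\<^bsub>H\<^esub> \<one>\<^bsub>H\<^esub>"
  and antipode_right: "h \<in> carrier H \<Longrightarrow>
    sweedler R H H (\<lambda>x y. x \<otimes>\<^bsub>H\<^esub> antipode H y) h = counit H h \<odot>\<^bsub>H\<^esub> \<one>\<^bsub>H\<^esub>"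

section \<open>Pairings\<close>

text \<open>A pairing is given by a linear map \<open>p\<close> on the tensor product; \<open>bracket R V W p v w\<close> is
  \<open>\<langle>v, w\<rangle> = p (v \<otimes> w)\<close>.\<close>

definition bracket ::
  "('k, 'r) ring_scheme \<Rightarrow> ('k, 'v, 'x) module_scheme \<Rightarrow> ('k, 'w, 'y) module_scheme
    \<Rightarrow> (('v \<times> 'w \<Rightarrow> 'k) set \<Rightarrow> 'k) \<Rightarrow> 'v \<Rightarrow> 'w \<Rightarrow> 'k"
  where "bracket R V W p v w = p (pure_tensor R V W v w)"

definition pairing ::
  "('k, 'r) ring_scheme \<Rightarrow> ('k, 'v, 'x) module_scheme \<Rightarrow> ('k, 'w, 'y) module_scheme
    \<Rightarrow> (('v \<times> 'w \<Rightarrow> 'k) set \<Rightarrow> 'k) \<Rightarrow> bool"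
  where "pairing R V W p \<longleftrightarrow>
    module R V \<and> module R W \<and> linear_map R (tensor R V W) (base_module R) p"

definition left_nondegenerate ::
  "('k, 'r) ring_scheme \<Rightarrow> ('k, 'v, 'x) module_scheme \<Rightarrow> ('k, 'w, 'y) module_scheme
    \<Rightarrow> (('v \<times> 'w \<Rightarrow> 'k) set \<Rightarrow> 'k) \<Rightarrow> bool"
  where "left_nondegenerate R V W p \<longleftrightarrow>
    (\<forall>v\<in>carrier V. (\<forall>w\<in>carrier W. bracket R V W p v w = \<zero>\<^bsub>R\<^esub>) \<longrightarrow> v = \<zero>\<^bsub>V\<^esub>)"

definition right_nondegenerate ::
  "('k, 'r) ring_scheme \<Rightarrow> ('k, 'v, 'x) module_scheme \<Rightarrow> ('k, 'w, 'y) module_scheme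
    \<Rightarrow> (('v \<times> 'w \<Rightarrow> 'k) set \<Rightarrow> 'k) \<Rightarrow> bool"
  where "right_nondegenerate R V W p \<longleftrightarrow>
    (\<forall>w\<in>carrier W. (\<forall>v\<in>carrier V. bracket R V W p v w = \<zero>\<^bsub>R\<^esub>) \<longrightarrow> w = \<zero>\<^bsub>W\<^esub>)"

text \<open>A morphism \<open>(V, V') \<rightarrow> (W, W')\<close> is covariant in the first and contravariant in the second component.\<close>

definition pairing_morphism ::
  "('k, 'r) ring_scheme
    \<Rightarrow> ('k, 'v, 'x) module_scheme \<Rightarrow> ('k, 'v', 'y) module_scheme \<Rightarrow> (('v \<times> 'v' \<Rightarrow> 'k) set \<Rightarrow> 'k)
    \<Rightarrow> ('k, 'w, 'z) module_scheme \<Rightarrow> ('k, 'w', 'u) module_scheme \<Rightarrow> (('w \<times> 'w' \<Rightarrow> 'k) set \<Rightarrow> 'k)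
    \<Rightarrow> ('v \<Rightarrow> 'w) \<Rightarrow> ('w' \<Rightarrow> 'v') \<Rightarrow> bool"
  where "pairing_morphism R V V' p W W' q f g \<longleftrightarrow>
    linear_map R V W f \<and> linear_map R W' V' g \<and>
    (\<forall>v\<in>carrier V. \<forall>w\<in>carrier W'. bracket R V V' p v (g w) = bracket R W W' q (f v) w)"

locale coalgebra_algebra_pairing = C: coalgebra R C + A: assoc_algebra R A
  for R :: "('k, 'r) ring_scheme" and C :: "('k, 'c, 'x) coalg_scheme"
    and A :: "('k, 'a, 'y) module_scheme" and p :: "('c \<times> 'a \<Rightarrow> 'k) set \<Rightarrow> 'k" +
  assumes pairing: "pairing R C A p"
  and bracket_one_right: "c \<in> carrier C \<Longrightarrow> bracket R C A p c \<one>\<^bsub>A\<^esub> = counit C c"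
  and bracket_mult_right: "\<lbrakk>c \<in> carrier C; a \<in> carrier A; b \<in> carrier A\<rbrakk> \<Longrightarrow>
    bracket R C A p c (a \<otimes>\<^bsub>A\<^esub> b) =
      sweedler R C (base_module R) (\<lambda>x y. bracket R C A p x a \<otimes>\<^bsub>R\<^esub> bracket R C A p y b) c"

locale hopf_pairing = H: hopf_algebra R H + K: hopf_algebra R K
  for R :: "('k, 'r) ring_scheme" and H :: "('k, 'h, 'x) hopf_scheme"
    and K :: "('k, 'l, 'y) hopf_scheme" and p :: "('h \<times> 'l \<Rightarrow> 'k) set \<Rightarrow> 'k" +
  assumes pairing: "pairing R H K p"
  and bracket_mult_right: "\<lbrakk>h \<in> carrier H; a \<in> carrier K; b \<in> carrier K\<rbrakk> \<Longrightarrow>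
    bracket R H K p h (a \<otimes>\<^bsub>K\<^esub> b) =
      sweedler R H (base_module R) (\<lambda>x y. bracket R H K p x a \<otimes>\<^bsub>R\<^esub> bracket R H K p y b) h"
  and bracket_mult_left: "\<lbrakk>h \<in> carrier H; g \<in> carrier H; a \<in> carrier K\<rbrakk> \<Longrightarrow>
    bracket R H K p (h \<otimes>\<^bsub>H\<^esub> g) a =
      sweedler R K (base_module R) (\<lambda>x y. bracket R H K p h x \<otimes>\<^bsub>R\<^esub> bracket R H K p g y) a"
  and bracket_one_right: "h \<in> carrier H \<Longrightarrow> bracket R H K p h \<one>\<^bsub>K\<^esub> = counit H h"
  and bracket_one_left: "a \<in> carrier K \<Longrightarrow> bracket R H K p \<one>\<^bsub>H\<^esub> a = counit K a"
  and bracket_antipode: "\<lbrakk>h \<in> carrier H; a \<in> carrier K\<rbrakk> \<Longrightarrow>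
    bracket R H K p (antipode H h) a = bracket R H K p h (antipode K a)"

section \<open>Partial representations and corepresentations\<close>

definition partial_representation ::
  "('k, 'r) ring_scheme \<Rightarrow> ('k, 'l, 'x) hopf_scheme \<Rightarrow> ('k, 'a, 'y) module_scheme \<Rightarrow> ('l \<Rightarrow> 'a) \<Rightarrow> bool"
  where "partial_representation R K A \<pi> \<longleftrightarrow>
    linear_map R K A \<pi> \<and>
    \<pi> \<one>\<^bsub>K\<^esub> = \<one>\<^bsub>A\<^esub> \<and>
    (\<forall>h\<in>carrier K. \<forall>l\<in>carrier K.
      sweedler R K A (\<lambda>l1 l2. \<pi> h \<otimes>\<^bsub>A\<^esub> \<pi> l1 \<otimes>\<^bsub>A\<^esub> \<pi> (antipode K l2)) l =
      sweedler R K A (\<lambda>l1 l2. \<pi> (h \<otimes>\<^bsub>K\<^esub> l1) \<otimes>\<^bsub>A\<^esub> \<pi> (antipode K l2)) l) \<and>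
    (\<forall>h\<in>carrier K. \<forall>l\<in>carrier K.
      sweedler R K A (\<lambda>h1 h2. \<pi> h1 \<otimes>\<^bsub>A\<^esub> \<pi> (antipode K h2) \<otimes>\<^bsub>A\<^esub> \<pi> l) h =
      sweedler R K A (\<lambda>h1 h2. \<pi> h1 \<otimes>\<^bsub>A\<^esub> \<pi> (antipode K h2 \<otimes>\<^bsub>K\<^esub> l)) h)"

text \<open>In the two identities in \<open>H \<otimes> H\<close>, \<open>u\<close> and \<open>v\<close> are the Sweedler components of
  \<open>\<omega>(c\<^sub>1)\<close>, respectively of \<open>\<omega>(c\<^sub>2)\<close>.\<close>

definition partial_corepresentation ::
  "('k, 'r) ring_scheme \<Rightarrow> ('k, 'c, 'x) coalg_scheme \<Rightarrow> ('k, 'h, 'y) hopf_scheme \<Rightarrow> ('c \<Rightarrow> 'h) \<Rightarrow> bool"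
  where "partial_corepresentation R C H \<omega> \<longleftrightarrow>
    linear_map R C H \<omega> \<and>
    (\<forall>c\<in>carrier C. counit H (\<omega> c) = counit C c) \<and>
    (\<forall>c\<in>carrier C.
      sweedler R C (tensor R H H) (\<lambda>c1 c2.
        sweedler R H (tensor R H H)
          (\<lambda>u v. pure_tensor R H H u (v \<otimes>\<^bsub>H\<^esub> antipode H (\<omega> c2))) (\<omega> c1)) c =
      sweedler3 R C (tensor R H H) (\<lambda>c1 c2 c3.
        pure_tensor R H H (\<omega> c1) (\<omega> c2 \<otimes>\<^bsub>H\<^esub> antipode H (\<omega> c3))) c) \<and>
    (\<forall>c\<in>carrier C.
      sweedler R C (tensor R H H) (\<lambda>c1 c2.
        sweedler R H (tensor R H H)
          (\<lambda>u v. pure_tensor R H H (\<omega> c1 \<otimes>\<^bsub>H\<^esub> antipode H u) v) (\<omega> c2)) c =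
      sweedler3 R C (tensor R H H) (\<lambda>c1 c2 c3.
        pure_tensor R H H (\<omega> c1 \<otimes>\<^bsub>H\<^esub> antipode H (\<omega> c2)) (\<omega> c3)) c)"

end

theory Submission
  imports Defs
begin

text \<open>Write \<open>\<Phi>\<^sub>h\<^sub>l\<close> for the functional \<open>\<langle>-, h\<rangle> \<otimes> \<langle>-, l\<rangle>\<close> on \<open>H \<otimes> H\<close>. Since \<open>\<langle>c, \<pi>(x)\<rangle> = \<langle>\<omega>(c), x\<rangle>\<close>, expanding products
  into Sweedler sums shows that \<open>\<Phi>\<^sub>h\<^sub>l\<close> sends each side of a corepresentation identity at \<open>c\<close> to the
  bracket of \<open>c\<close> with the opposite side of the corresponding representation identity at \<open>h, l\<close>.
  Right non-degeneracy of \<open>(C, A)\<close> cancels \<open>c\<close>, which gives the first claim. For the second one, the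
  functionals \<open>\<Phi>\<^sub>h\<^sub>l\<close> separate the elements of \<open>H \<otimes> H\<close> when \<open>k\<close> is a field and \<open>(H, K)\<close> is left
  non-degenerate.\<close>

subsection \<open>Linear maps\<close>

text \<open>The sides are crossed because the product of \<open>K\<close> is dual to the coproduct
  of \<open>H\<close>, whereas the product of \<open>A\<close> is dual to the coproduct of
  \<open>C\<close>: splitting a value of \<open>\<omega>\<close> in \<open>H\<close> multiplies
  arguments inside one \<open>\<pi>\<close>, and splitting \<open>c\<close> gives a product of
  separate values of \<open>\<pi>\<close>. What shapes the calculations is that a Sweedler sum is
  evaluated on a chosen representative of a coset, so it has a meaning only for a bilinear summand.
  Changing the summand, moving a linear map under the sum and exchanging two sums all carry
  bilinearity conditions; all three rest on the fact that linear maps on a tensor product agree once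
  they agree on pure tensors. The field enters in the separation of tensors. An injective map from
  \<open>H\<close> to the dual of \<open>K\<close> need not stay injective on passing to
  \<open>H \<otimes> H\<close> over a general ring. Over a field, the inverse of a nonzero bracket
  value shortens a sum of pure tensors by one summand, and an induction on the number of summands
  replaces the choice of a basis.\<close>

lemma (in abelian_group) eq_if_minus_eq_zero:
  assumes "x \<ominus> y = \<zero>" "x \<in> carrier G" "y \<in> carrier G"
  shows "x = y"
  using assms minus_equality[of x "\<ominus> y"] by (simp add: minus_eq)

lemma linear_mapI:
  assumes "\<And>x. x \<in> carrier M \<Longrightarrow> f x \<in> carrier N"
    and "\<And>x y. \<lbrakk>x \<in> carrier M; y \<in> carrier M\<rbrakk> \<Longrightarrow> f (x \<oplus>\<^bsub>M\<^esub> y) = f x \<oplus>\<^bsub>N\<^esub> f y"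
    and "\<And>r x. \<lbrakk>r \<in> carrier R; x \<in> carrier M\<rbrakk> \<Longrightarrow> f (r \<odot>\<^bsub>M\<^esub> x) = r \<odot>\<^bsub>N\<^esub> f x"
  shows "linear_map R M N f"
  using assms by (auto simp: linear_map_def)

lemma linear_mapD:
  assumes "linear_map R M N f"
  shows linear_map_closed: "x \<in> carrier M \<Longrightarrow> f x \<in> carrier N"
    and linear_map_add: "\<lbrakk>x \<in> carrier M; y \<in> carrier M\<rbrakk> \<Longrightarrow> f (x \<oplus>\<^bsub>M\<^esub> y) = f x \<oplus>\<^bsub>N\<^esub> f y"
    and linear_map_smult: "\<lbrakk>r \<in> carrier R; x \<in> carrier M\<rbrakk> \<Longrightarrow> f (r \<odot>\<^bsub>M\<^esub> x) = r \<odot>\<^bsub>N\<^esub> f x"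
  using assms by (auto simp: linear_map_def)

lemma linear_map_zero:
  assumes "module R M" "module R N" "linear_map R M N f"
  shows "f \<zero>\<^bsub>M\<^esub> = \<zero>\<^bsub>N\<^esub>"
proof -
  interpret M: module R M by fact
  interpret N: module R N by fact
  have "f (\<zero>\<^bsub>R\<^esub> \<odot>\<^bsub>M\<^esub> \<zero>\<^bsub>M\<^esub>) = \<zero>\<^bsub>R\<^esub> \<odot>\<^bsub>N\<^esub> f \<zero>\<^bsub>M\<^esub>"
    using assms(3) by (intro linear_map_smult) auto
  then show ?thesis
    using linear_map_closed[OF assms(3) M.M.zero_closed] by simp
qed

lemma linear_map_uminus:
  assumes "module R M" "module R N" "linear_map R M N f" "x \<in> carrier M"
  shows "f (\<ominus>\<^bsub>M\<^esub> x) = \<ominus>\<^bsub>N\<^esub> f x"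
proof -
  interpret M: module R M by fact
  interpret N: module R N by fact
  have "f ((\<ominus>\<^bsub>R\<^esub> \<one>\<^bsub>R\<^esub>) \<odot>\<^bsub>M\<^esub> x) = (\<ominus>\<^bsub>R\<^esub> \<one>\<^bsub>R\<^esub>) \<odot>\<^bsub>N\<^esub> f x"
    using assms(3,4) by (intro linear_map_smult) auto
  then show ?thesis
    using linear_map_closed[OF assms(3,4)] assms(4)
    by (simp add: M.smult_l_minus N.smult_l_minus)
qed

lemma linear_map_minus:
  assumes "module R M" "module R N" "linear_map R M N f" "x \<in> carrier M" "y \<in> carrier M"
  shows "f (x \<ominus>\<^bsub>M\<^esub> y) = f x \<ominus>\<^bsub>N\<^esub> f y"
proof -
  interpret M: module R M by fact
  show ?thesis
    using assms by (simp add: a_minus_def linear_map_add[OF assms(3)] linear_map_uminus[OF assms(1-3)])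
qed

lemma linear_map_compose:
  assumes "linear_map R N P f" "linear_map R M N g"
  shows "linear_map R M P (\<lambda>x. f (g x))"
  using assms by (auto simp: linear_map_def Pi_iff)

lemma linear_map_cong:
  assumes "module R M" "\<And>x. x \<in> carrier M \<Longrightarrow> f x = g x"
  shows "linear_map R M N f \<longleftrightarrow> linear_map R M N g"
proof -
  interpret M: module R M by fact
  show ?thesis
    using assms(2) by (auto simp: linear_map_def Pi_iff)
qed

section \<open>The base ring as a module over itself\<close>

lemma base_module_simps [simp]:
  "carrier (base_module R) = carrier R" "zero (base_module R) = zero R"
  "add (base_module R) = add R" "smult (base_module R) = mult R"
  by (simp_all add: base_module_def)

lemma a_inv_base_module [simp]: "a_inv (base_module R) = a_inv R"
  by (rule ext) (simp add: a_inv_def m_inv_def)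

lemma module_base_module:
  assumes "cring R"
  shows "module R (base_module R)"
proof -
  interpret cring R by fact
  show ?thesis
  proof (rule moduleI)
    show "abelian_group (base_module R)"
      by (rule abelian_groupI) (auto intro: add.m_assoc add.m_comm)
  qed (auto simp: assms l_distr r_distr m_assoc)
qed

section \<open>Kernels and spans as submodules\<close>

lemma submodule_kernel:
  assumes "module R M" "module R N" "linear_map R M N f"
  shows "submodule {x \<in> carrier M. f x = \<zero>\<^bsub>N\<^esub>} R M"
proof -
  interpret M: module R M by fact
  interpret N: module R N by fact
  show ?thesis
    by (rule M.submoduleI)
      (auto simp: linear_map_zero[OF assms] linear_map_uminus[OF assms] linear_mapD[OF assms(3)])
qed

text \<open>The condition on \<open>X\<close> puts the whole carrier into the intersected family,
  which keeps the intersection inside the carrier.\<close>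

lemma submodule_submodule_span:
  assumes "module R M" "X \<subseteq> carrier M"
  shows "submodule (submodule_span R M X) R M"
proof -
  interpret M: module R M by fact
  have "carrier M \<in> {N. submodule N R M \<and> X \<subseteq> N}"
    using M.carrier_is_submodule assms(2) by simp
  moreover have "\<zero>\<^bsub>M\<^esub> \<in> N" if "submodule N R M" for N
    using subgroup.one_closed[OF submodule.axioms(1)[OF that]] by simp
  ultimately show ?thesis
    unfolding submodule_span_def
    by (intro M.submoduleI) (auto intro: M.submoduleE)
qed

lemma abelian_subgroup_submodule:
  assumes "module R M" "submodule N R M"
  shows "abelian_subgroup N M"
proof -
  interpret M: module R M by fact
  show ?thesis
    using submodule.axioms(1)[OF assms(2)]
    by (intro abelian_subgroupI3 additive_subgroup.intro M.abelian_group_axioms)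
qed

subsection \<open>Quotient modules\<close>

lemma quotient_module_carrier:
  "carrier (quotient_module M N) = (\<lambda>x. N +>\<^bsub>M\<^esub> x) ` carrier M"
  by (auto simp: quotient_module_def A_RCOSETS_def')

lemma quotient_module_add:
  assumes "module R M" "submodule N R M" "x \<in> carrier M" "y \<in> carrier M"
  shows "(N +>\<^bsub>M\<^esub> x) \<oplus>\<^bsub>quotient_module M N\<^esub> (N +>\<^bsub>M\<^esub> y) = N +>\<^bsub>M\<^esub> (x \<oplus>\<^bsub>M\<^esub> y)"
  using abelian_subgroup.a_rcos_sum[OF abelian_subgroup_submodule[OF assms(1,2)] assms(3,4)]
  by (simp add: quotient_module_def)

text \<open>Scalar multiplication of a coset is a union over all its representatives. Two
  representatives differ by an element of \<open>N\<close>, and so do their multiples; the union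
  thus consists of copies of one coset, over a non-empty index set.\<close>

lemma quotient_module_smult:
  assumes "module R M" "submodule N R M" "r \<in> carrier R" "x \<in> carrier M"
  shows "r \<odot>\<^bsub>quotient_module M N\<^esub> (N +>\<^bsub>M\<^esub> x) = N +>\<^bsub>M\<^esub> (r \<odot>\<^bsub>M\<^esub> x)"
proof -
  interpret M: module R M by fact
  interpret N: submodule N R M by fact
  interpret N: abelian_subgroup N M by (rule abelian_subgroup_submodule[OF assms(1,2)])
  have "N +>\<^bsub>M\<^esub> (r \<odot>\<^bsub>M\<^esub> y) = N +>\<^bsub>M\<^esub> (r \<odot>\<^bsub>M\<^esub> x)" if y: "y \<in> N +>\<^bsub>M\<^esub> x" for y
  proof -
    obtain n where n: "n \<in> N" "y = n \<oplus>\<^bsub>M\<^esub> x"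
      using y by (auto simp: a_r_coset_def')
    have "r \<odot>\<^bsub>M\<^esub> y = r \<odot>\<^bsub>M\<^esub> n \<oplus>\<^bsub>M\<^esub> r \<odot>\<^bsub>M\<^esub> x"
      using n assms(3,4) by (simp add: M.smult_r_distr)
    then have "r \<odot>\<^bsub>M\<^esub> y \<in> N +>\<^bsub>M\<^esub> (r \<odot>\<^bsub>M\<^esub> x)"
      using n N.smult_closed[OF assms(3)] by (auto simp: a_r_coset_def')
    from M.a_repr_independence[OF this _ N.a_subgroup] show ?thesis
      using assms(3,4) by simp
  qed
  moreover have "x \<in> N +>\<^bsub>M\<^esub> x"
    using N.a_rcos_self assms(4) by simp
  ultimately have "(\<Union>y\<in>N +>\<^bsub>M\<^esub> x. N +>\<^bsub>M\<^esub> (r \<odot>\<^bsub>M\<^esub> y)) = N +>\<^bsub>M\<^esub> (r \<odot>\<^bsub>M\<^esub> x)"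
    by blast
  then show ?thesis
    by (simp add: quotient_module_def)
qed

lemma module_quotient_module:
  assumes "module R M" "submodule N R M"
  shows "module R (quotient_module M N)"
proof -
  interpret M: module R M by fact
  interpret N: submodule N R M by fact
  interpret N: abelian_subgroup N M by (rule abelian_subgroup_submodule[OF assms(1,2)])
  let ?Q = "quotient_module M N"
  have zero: "\<zero>\<^bsub>?Q\<^esub> = N +>\<^bsub>M\<^esub> \<zero>\<^bsub>M\<^esub>"
    using M.a_coset_add_zero[OF N.a_subset] by (simp add: quotient_module_def)
  note simps = zero quotient_module_carrier quotient_module_add[OF assms] quotient_module_smult[OF assms]
  have inverse: "\<exists>X\<in>carrier ?Q. X \<oplus>\<^bsub>?Q\<^esub> (N +>\<^bsub>M\<^esub> x) = \<zero>\<^bsub>?Q\<^esub>" if "x \<in> carrier M" for x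
  proof (rule bexI)
    show "(N +>\<^bsub>M\<^esub> (\<ominus>\<^bsub>M\<^esub> x)) \<oplus>\<^bsub>?Q\<^esub> (N +>\<^bsub>M\<^esub> x) = \<zero>\<^bsub>?Q\<^esub>"
      using that by (simp add: simps M.l_neg)
    show "N +>\<^bsub>M\<^esub> (\<ominus>\<^bsub>M\<^esub> x) \<in> carrier ?Q"
      using that by (auto simp: quotient_module_carrier)
  qed
  show ?thesis
  proof (rule moduleI)
    show "cring R" ..
    show "abelian_group ?Q"
    proof (rule abelian_groupI)
      show "\<exists>Y\<in>carrier ?Q. Y \<oplus>\<^bsub>?Q\<^esub> X = \<zero>\<^bsub>?Q\<^esub>" if "X \<in> carrier ?Q" for X
        using that inverse by (auto simp: quotient_module_carrier)
    qed (auto simp: simps M.a_ac)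
  qed (auto simp: simps M.smult_l_distr M.smult_r_distr M.smult_assoc1)
qed

subsection \<open>Free modules\<close>

lemma free_module_simps [simp]:
  "zero (free_module R I) = (\<lambda>_. \<zero>\<^bsub>R\<^esub>)"
  "f \<oplus>\<^bsub>free_module R I\<^esub> g = (\<lambda>i. f i \<oplus>\<^bsub>R\<^esub> g i)"
  "r \<odot>\<^bsub>free_module R I\<^esub> f = (\<lambda>i. r \<otimes>\<^bsub>R\<^esub> f i)"
  by (simp_all add: free_module_def)

lemma free_moduleD:
  assumes "f \<in> carrier (free_module R I)"
  shows "finite {i. f i \<noteq> \<zero>\<^bsub>R\<^esub>}" "{i. f i \<noteq> \<zero>\<^bsub>R\<^esub>} \<subseteq> I" "f i \<in> carrier R"
  using assms by (auto simp: free_module_def)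

lemma free_moduleI:
  assumes "finite S" "S \<subseteq> I" "\<And>i. f i \<in> carrier R" "\<And>i. i \<notin> S \<Longrightarrow> f i = \<zero>\<^bsub>R\<^esub>"
  shows "f \<in> carrier (free_module R I)"
proof -
  have "{i. f i \<noteq> \<zero>\<^bsub>R\<^esub>} \<subseteq> S"
    using assms(4) by auto
  then show ?thesis
    using assms by (auto simp: free_module_def intro: finite_subset)
qed

lemma module_free_module:
  assumes "cring R"
  shows "module R (free_module R I)"
proof -
  interpret cring R by fact
  let ?F = "free_module R I"
  have add: "(\<lambda>i. f i \<oplus>\<^bsub>R\<^esub> g i) \<in> carrier ?F" if "f \<in> carrier ?F" "g \<in> carrier ?F" for f g
    using free_moduleD[OF that(1)] free_moduleD[OF that(2)]
    by (intro free_moduleI[where S = "{i. f i \<noteq> \<zero>\<^bsub>R\<^esub>} \<union> {i. g i \<noteq> \<zero>\<^bsub>R\<^esub>}"]) auto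
  have smult: "(\<lambda>i. r \<otimes>\<^bsub>R\<^esub> f i) \<in> carrier ?F" if "r \<in> carrier R" "f \<in> carrier ?F" for r f
    using free_moduleD[OF that(2)] that(1)
    by (intro free_moduleI[where S = "{i. f i \<noteq> \<zero>\<^bsub>R\<^esub>}"]) auto
  have inverse: "\<exists>g\<in>carrier ?F. g \<oplus>\<^bsub>?F\<^esub> f = \<zero>\<^bsub>?F\<^esub>" if "f \<in> carrier ?F" for f
  proof (rule bexI)
    show "(\<lambda>i. (\<ominus>\<^bsub>R\<^esub> \<one>\<^bsub>R\<^esub>) \<otimes>\<^bsub>R\<^esub> f i) \<oplus>\<^bsub>?F\<^esub> f = \<zero>\<^bsub>?F\<^esub>"
      using free_moduleD(3)[OF that] by (simp add: l_minus l_neg)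
    show "(\<lambda>i. (\<ominus>\<^bsub>R\<^esub> \<one>\<^bsub>R\<^esub>) \<otimes>\<^bsub>R\<^esub> f i) \<in> carrier ?F"
      using that by (intro smult) auto
  qed
  have zero: "(\<lambda>_. \<zero>\<^bsub>R\<^esub>) \<in> carrier ?F"
    by (rule free_moduleI[where S = "{}"]) auto
  show ?thesis
  proof (rule moduleI)
    show "abelian_group ?F"
      by (rule abelian_groupI) (use inverse in \<open>auto simp: zero add a_ac free_moduleD(3)\<close>)
  qed (auto simp: assms smult l_distr r_distr m_assoc free_moduleD(3))
qed

lemma free_gen_closed:
  assumes "cring R" "i \<in> I"
  shows "free_gen R i \<in> carrier (free_module R I)"
proof -
  interpret cring R by fact
  show ?thesis
    using assms(2) by (intro free_moduleI[where S = "{i}"]) (auto simp: free_gen_def)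
qed

lemma free_module_induct [consumes 2, case_names zero add]:
  assumes "cring R" "f \<in> carrier (free_module R I)"
    and zero: "P \<zero>\<^bsub>free_module R I\<^esub>"
    and add: "\<And>r i f. \<lbrakk>r \<in> carrier R; i \<in> I; f \<in> carrier (free_module R I); P f\<rbrakk>
      \<Longrightarrow> P (r \<odot>\<^bsub>free_module R I\<^esub> free_gen R i \<oplus>\<^bsub>free_module R I\<^esub> f)"
  shows "P f"
proof -
  interpret cring R by fact
  \<comment> \<open>Requiring the support to lie in \<open>S\<close>, rather than to equal it, keeps
    the induction uniform: coordinate \<open>i\<close> is erased even when \<open>f i\<close> is
    already zero.\<close>
  have "finite S \<Longrightarrow> S \<subseteq> I \<Longrightarrow> {i. f i \<noteq> \<zero>\<^bsub>R\<^esub>} \<subseteq> S \<Longrightarrow> range f \<subseteq> carrier R \<Longrightarrow> P f" for S f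
  proof (induction S arbitrary: f rule: finite_induct)
    case empty
    then have "f = \<zero>\<^bsub>free_module R I\<^esub>" by auto
    then show ?case using zero by simp
  next
    case (insert i S)
    let ?g = "f(i := \<zero>\<^bsub>R\<^esub>)"
    have carr: "f j \<in> carrier R" for j using insert.prems by auto
    have supp: "j = i \<or> j \<in> S" if "f j \<noteq> \<zero>\<^bsub>R\<^esub>" for j using that insert.prems by auto
    have "P ?g"
      using insert.prems supp by (intro insert.IH) auto
    moreover have "?g \<in> carrier (free_module R I)"
      using insert.prems insert.hyps(1) supp carr by (intro free_moduleI[where S = S]) auto
    ultimately have "P (f i \<odot>\<^bsub>free_module R I\<^esub> free_gen R i \<oplus>\<^bsub>free_module R I\<^esub> ?g)"
      using insert.prems carr by (intro add) auto
    moreover have "f i \<odot>\<^bsub>free_module R I\<^esub> free_gen R i \<oplus>\<^bsub>free_module R I\<^esub> ?g = f"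
      using carr by (auto simp: free_gen_def)
    ultimately show ?case by simp
  qed
  from this[of "{i. f i \<noteq> \<zero>\<^bsub>R\<^esub>}" f] show ?thesis
    using assms(2) by (simp add: free_module_def)
qed

text \<open>The linear extension of \<open>b\<close> from the generators. It is the sum inside
  \<open>tensor_lift\<close>, with the representative as an argument instead of a choice.\<close>

definition free_lift ::
  "('k, 'r) ring_scheme \<Rightarrow> ('k, 'p, 'z) module_scheme \<Rightarrow> ('i \<Rightarrow> 'p) \<Rightarrow> ('i \<Rightarrow> 'k) \<Rightarrow> 'p"
  where "free_lift R P b f = (\<Oplus>\<^bsub>P\<^esub>i\<in>{i. f i \<noteq> \<zero>\<^bsub>R\<^esub>}. f i \<odot>\<^bsub>P\<^esub> b i)"

text \<open>Cancellation can make the support of a sum smaller than the union of the supports, and a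
  scalar can shrink a support too. Summation over a common larger set makes such sums comparable,
  since the added terms vanish.\<close>

lemma free_lift_superset:
  assumes "module R P" "b \<in> I \<rightarrow> carrier P" "f \<in> carrier (free_module R I)"
    and "finite S" "S \<subseteq> I" "{i. f i \<noteq> \<zero>\<^bsub>R\<^esub>} \<subseteq> S"
  shows "free_lift R P b f = (\<Oplus>\<^bsub>P\<^esub>i\<in>S. f i \<odot>\<^bsub>P\<^esub> b i)"
proof -
  interpret P: module R P by fact
  have "b i \<in> carrier P" if "i \<in> S" for i
    using that assms(2,5) by auto
  then show ?thesis
    unfolding free_lift_def
    using assms free_moduleD(3)[OF assms(3)]
    by (intro P.add.finprod_mono_neutral_cong_left) auto
qed

lemma linear_map_free_lift:
  assumes "module R P" "b \<in> I \<rightarrow> carrier P"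
  shows "linear_map R (free_module R I) P (free_lift R P b)"
proof -
  interpret P: module R P by fact
  let ?F = "free_module R I"
  interpret F: module R ?F by (rule module_free_module) (rule P.R.is_cring)
  have b: "b i \<in> carrier P" if "i \<in> I" for i using assms(2) that by auto
  show ?thesis
  proof (rule linear_mapI)
    fix f assume f: "f \<in> carrier ?F"
    note f' = free_moduleD[OF f]
    then show "free_lift R P b f \<in> carrier P"
      unfolding free_lift_def using b by (intro P.finsum_closed) auto
    {
      fix g assume g: "g \<in> carrier ?F"
      note g' = free_moduleD[OF g]
      let ?S = "{i. f i \<noteq> \<zero>\<^bsub>R\<^esub>} \<union> {i. g i \<noteq> \<zero>\<^bsub>R\<^esub>}"
      have S: "finite ?S" "?S \<subseteq> I" using f' g' by auto
      have "free_lift R P b (f \<oplus>\<^bsub>?F\<^esub> g) = (\<Oplus>\<^bsub>P\<^esub>i\<in>?S. (f i \<oplus>\<^bsub>R\<^esub> g i) \<odot>\<^bsub>P\<^esub> b i)"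
        using S F.add.m_closed[OF f g] by (subst free_lift_superset[OF assms, where S = ?S]) auto
      also have "\<dots> = (\<Oplus>\<^bsub>P\<^esub>i\<in>?S. f i \<odot>\<^bsub>P\<^esub> b i \<oplus>\<^bsub>P\<^esub> g i \<odot>\<^bsub>P\<^esub> b i)"
        using S(2) f'(3) g'(3) b by (intro P.M.finsum_cong') (auto simp: P.smult_l_distr subset_eq)
      also have "\<dots> = (\<Oplus>\<^bsub>P\<^esub>i\<in>?S. f i \<odot>\<^bsub>P\<^esub> b i) \<oplus>\<^bsub>P\<^esub> (\<Oplus>\<^bsub>P\<^esub>i\<in>?S. g i \<odot>\<^bsub>P\<^esub> b i)"
        using S(2) f'(3) g'(3) b by (intro P.M.finsum_addf) (auto simp: subset_eq)
      also have "(\<Oplus>\<^bsub>P\<^esub>i\<in>?S. f i \<odot>\<^bsub>P\<^esub> b i) = free_lift R P b f"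
        using S by (intro free_lift_superset[OF assms f, symmetric]) auto
      also have "(\<Oplus>\<^bsub>P\<^esub>i\<in>?S. g i \<odot>\<^bsub>P\<^esub> b i) = free_lift R P b g"
        using S by (intro free_lift_superset[OF assms g, symmetric]) auto
      finally show "free_lift R P b (f \<oplus>\<^bsub>?F\<^esub> g) = free_lift R P b f \<oplus>\<^bsub>P\<^esub> free_lift R P b g" .
    }
    fix r assume r: "r \<in> carrier R"
    let ?S = "{i. f i \<noteq> \<zero>\<^bsub>R\<^esub>}"
    have "free_lift R P b (r \<odot>\<^bsub>?F\<^esub> f) = (\<Oplus>\<^bsub>P\<^esub>i\<in>?S. (r \<otimes>\<^bsub>R\<^esub> f i) \<odot>\<^bsub>P\<^esub> b i)"
      using f' r F.smult_closed[OF r f] by (subst free_lift_superset[OF assms, where S = ?S]) auto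
    also have "\<dots> = (\<Oplus>\<^bsub>P\<^esub>i\<in>?S. r \<odot>\<^bsub>P\<^esub> (f i \<odot>\<^bsub>P\<^esub> b i))"
      using f' r b by (intro P.M.finsum_cong') (auto simp: P.smult_assoc1 subset_eq)
    also have "\<dots> = r \<odot>\<^bsub>P\<^esub> free_lift R P b f"
      unfolding free_lift_def using f' r b by (intro P.finsum_smult_ldistr[symmetric]) auto
    finally show "free_lift R P b (r \<odot>\<^bsub>?F\<^esub> f) = r \<odot>\<^bsub>P\<^esub> free_lift R P b f" .
  qed
qed

lemma free_lift_gen:
  assumes "module R P" "b \<in> I \<rightarrow> carrier P" "i \<in> I"
  shows "free_lift R P b (free_gen R i) = b i"
proof -
  interpret P: module R P by fact
  have "b i \<in> carrier P" using assms by auto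
  moreover have "free_lift R P b (free_gen R i) = (\<Oplus>\<^bsub>P\<^esub>j\<in>{i}. free_gen R i j \<odot>\<^bsub>P\<^esub> b j)"
    using assms by (intro free_lift_superset free_gen_closed P.R.is_cring) (auto simp: free_gen_def)
  ultimately show ?thesis
    by (simp add: free_gen_def)
qed

subsection \<open>Tensor products\<close>

text \<open>Phrased as linearity in each variable separately, so that the composition rules for
  linear maps handle one variable at a time.\<close>

definition bilinear_map ::
  "('k, 'r) ring_scheme \<Rightarrow> ('k, 'm, 'x) module_scheme \<Rightarrow> ('k, 'n, 'y) module_scheme
    \<Rightarrow> ('k, 'p, 'z) module_scheme \<Rightarrow> ('m \<Rightarrow> 'n \<Rightarrow> 'p) \<Rightarrow> bool"
  where "bilinear_map R M N P B \<longleftrightarrow>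
    (\<forall>x\<in>carrier M. linear_map R N P (B x)) \<and>
    (\<forall>y\<in>carrier N. linear_map R M P (\<lambda>x. B x y))"

lemma bilinear_mapI:
  assumes "\<And>x. x \<in> carrier M \<Longrightarrow> linear_map R N P (B x)"
    and "\<And>y. y \<in> carrier N \<Longrightarrow> linear_map R M P (\<lambda>x. B x y)"
  shows "bilinear_map R M N P B"
  using assms by (auto simp: bilinear_map_def)

lemma bilinear_mapD:
  assumes "bilinear_map R M N P B"
  shows bilinear_map_right: "x \<in> carrier M \<Longrightarrow> linear_map R N P (B x)"
    and bilinear_map_left: "y \<in> carrier N \<Longrightarrow> linear_map R M P (\<lambda>x. B x y)"
  using assms by (auto simp: bilinear_map_def)

lemma bilinear_map_closed:
  assumes "bilinear_map R M N P B" "x \<in> carrier M" "y \<in> carrier N"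
  shows "B x y \<in> carrier P"
  using bilinear_map_right[OF assms(1,2)] assms(3) by (rule linear_map_closed)

lemma linear_map_bilinear_map:
  assumes "bilinear_map R M N P B" "linear_map R P Q f"
  shows "bilinear_map R M N Q (\<lambda>x y. f (B x y))"
  using assms by (auto simp: bilinear_map_def intro: linear_map_compose)

section \<open>Construction of the tensor product and its universal property\<close>

lemma tensor_relators_closed:
  assumes "module R M" "module R N"
  shows "tensor_relators R M N \<subseteq> carrier (free_module R (carrier M \<times> carrier N))"
proof -
  interpret M: module R M by fact
  interpret N: module R N by fact
  let ?F = "free_module R (carrier M \<times> carrier N)"
  interpret F: module R ?F by (rule module_free_module) (rule M.R.is_cring)
  have gen: "free_gen R (x, y) \<in> carrier ?F" if "x \<in> carrier M" "y \<in> carrier N" for x y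
    using that by (intro free_gen_closed M.R.is_cring) auto
  show ?thesis
    unfolding tensor_relators_def Let_def
    by (auto simp del: free_module_simps simp: gen)
qed

lemma submodule_tensor_null:
  assumes "module R M" "module R N"
  shows "submodule (tensor_null R M N) R (free_module R (carrier M \<times> carrier N))"
  unfolding tensor_null_def
  using assms module.axioms(1) by (intro submodule_submodule_span module_free_module tensor_relators_closed) auto

lemma module_tensor:
  assumes "module R M" "module R N"
  shows "module R (tensor R M N)"
  unfolding tensor_def
  using assms module.axioms(1) by (intro module_quotient_module module_free_module submodule_tensor_null) auto

lemma linear_map_tensor_coset:
  assumes "module R M" "module R N"
  shows "linear_map R (free_module R (carrier M \<times> carrier N)) (tensor R M N)
    (\<lambda>f. tensor_null R M N +>\<^bsub>free_module R (carrier M \<times> carrier N)\<^esub> f)"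
proof -
  have "cring R" using assms(1) by (rule module.axioms)
  note quot = module_free_module[OF this, of "carrier M \<times> carrier N"] submodule_tensor_null[OF assms]
  show ?thesis
    by (rule linear_mapI)
      (simp_all add: tensor_def quotient_module_carrier quotient_module_add[OF quot, symmetric]
        quotient_module_smult[OF quot, symmetric] del: free_module_simps)
qed

text \<open>Tailored to the bilinearity of \<open>pure_tensor\<close>: in each of its additivity and
  homogeneity laws the two representatives differ by a single relator.\<close>

lemma tensor_coset_eqI:
  assumes "module R M" "module R N"
    and "f \<in> carrier (free_module R (carrier M \<times> carrier N))"
    and "g \<in> carrier (free_module R (carrier M \<times> carrier N))"
    and "f \<ominus>\<^bsub>free_module R (carrier M \<times> carrier N)\<^esub> g \<in> tensor_relators R M N"
  shows "tensor_null R M N +>\<^bsub>free_module R (carrier M \<times> carrier N)\<^esub> f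
    = tensor_null R M N +>\<^bsub>free_module R (carrier M \<times> carrier N)\<^esub> g"
proof -
  have "cring R" using assms(1) by (rule module.axioms)
  note quot = module_free_module[OF this, of "carrier M \<times> carrier N"] submodule_tensor_null[OF assms(1,2)]
  interpret abelian_subgroup "tensor_null R M N" "free_module R (carrier M \<times> carrier N)"
    by (rule abelian_subgroup_submodule[OF quot])
  have "f \<ominus>\<^bsub>free_module R (carrier M \<times> carrier N)\<^esub> g \<in> tensor_null R M N"
    using assms(5) by (auto simp: tensor_null_def submodule_span_def)
  then have "f \<in> tensor_null R M N +>\<^bsub>free_module R (carrier M \<times> carrier N)\<^esub> g"
    using assms(3,4) by (simp add: a_rcos_module a_minus_def)
  then show ?thesis
    using a_repr_independence' assms(4) by simp
qed

lemma bilinear_map_pure_tensor: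
  assumes "module R M" "module R N"
  shows "bilinear_map R M N (tensor R M N) (pure_tensor R M N)"
proof -
  interpret M: module R M by fact
  interpret N: module R N by fact
  let ?F = "free_module R (carrier M \<times> carrier N)"
  interpret F: module R ?F by (rule module_free_module) (rule M.R.is_cring)
  let ?c = "\<lambda>f. tensor_null R M N +>\<^bsub>?F\<^esub> f"
  have gen: "free_gen R (x, y) \<in> carrier ?F" if "x \<in> carrier M" "y \<in> carrier N" for x y
    using that by (intro free_gen_closed M.R.is_cring) auto
  note lin = linear_map_tensor_coset[OF assms]
  note [simp] = gen linear_map_add[OF lin, symmetric] linear_map_smult[OF lin, symmetric]
  note [simp del] = free_module_simps
  note eq = tensor_coset_eqI[OF assms]
  show ?thesis
  proof (intro bilinear_mapI linear_mapI; unfold pure_tensor_def)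
    fix x y assume "x \<in> carrier M" "y \<in> carrier N"
    then show "?c (free_gen R (x, y)) \<in> carrier (tensor R M N)"
      by (intro linear_map_closed[OF lin] gen)
    then show "?c (free_gen R (x, y)) \<in> carrier (tensor R M N)" .
  next
    fix x y y' assume "x \<in> carrier M" "y \<in> carrier N" "y' \<in> carrier N"
    then show "?c (free_gen R (x, y \<oplus>\<^bsub>N\<^esub> y')) = ?c (free_gen R (x, y)) \<oplus>\<^bsub>tensor R M N\<^esub> ?c (free_gen R (x, y'))"
      by simp (rule eq, simp_all add: tensor_relators_def Let_def, blast)
  next
    fix x x' y assume "x \<in> carrier M" "x' \<in> carrier M" "y \<in> carrier N"
    then show "?c (free_gen R (x \<oplus>\<^bsub>M\<^esub> x', y)) = ?c (free_gen R (x, y)) \<oplus>\<^bsub>tensor R M N\<^esub> ?c (free_gen R (x', y))"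
      by simp (rule eq, simp_all add: tensor_relators_def Let_def, blast)
  next
    fix r x y assume "r \<in> carrier R" "x \<in> carrier M" "y \<in> carrier N"
    then show "?c (free_gen R (x, r \<odot>\<^bsub>N\<^esub> y)) = r \<odot>\<^bsub>tensor R M N\<^esub> ?c (free_gen R (x, y))"
      by simp (rule eq, simp_all add: tensor_relators_def Let_def, blast)
  next
    fix r x y assume "r \<in> carrier R" "x \<in> carrier M" "y \<in> carrier N"
    then show "?c (free_gen R (r \<odot>\<^bsub>M\<^esub> x, y)) = r \<odot>\<^bsub>tensor R M N\<^esub> ?c (free_gen R (x, y))"
      by simp (rule eq, simp_all add: tensor_relators_def Let_def, blast)
  qed
qed

lemmas pure_tensor_closed = bilinear_map_closed[OF bilinear_map_pure_tensor]

text \<open>No scalar occurs in the step because it can be absorbed into the first factor of a pure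
  tensor; every tensor is a plain sum of pure tensors.\<close>

lemma tensor_induct [consumes 3, case_names zero add]:
  assumes "module R M" "module R N" "t \<in> carrier (tensor R M N)"
    and zero: "P \<zero>\<^bsub>tensor R M N\<^esub>"
    and add: "\<And>x y t. \<lbrakk>x \<in> carrier M; y \<in> carrier N; t \<in> carrier (tensor R M N); P t\<rbrakk>
      \<Longrightarrow> P (pure_tensor R M N x y \<oplus>\<^bsub>tensor R M N\<^esub> t)"
  shows "P t"
proof -
  interpret M: module R M by fact
  let ?F = "free_module R (carrier M \<times> carrier N)"
  let ?c = "\<lambda>f. tensor_null R M N +>\<^bsub>?F\<^esub> f"
  interpret F: module R ?F by (rule module_free_module) (rule M.R.is_cring)
  note lin = linear_map_tensor_coset[OF assms(1,2)]
  obtain f where f: "f \<in> carrier ?F" "t = ?c f"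
    using assms(3) by (auto simp: tensor_def quotient_module_carrier)
  have "P (?c f)"
    using M.R.is_cring f(1)
  proof (induction rule: free_module_induct)
    case zero
    then show ?case
      using assms(4) linear_map_zero[OF F.module_axioms module_tensor[OF assms(1,2)] lin] by metis
  next
    case (add r i f)
    obtain x y where i: "i = (x, y)" by fastforce
    have xy: "x \<in> carrier M" "y \<in> carrier N" using add i by auto
    have gen: "free_gen R (r \<odot>\<^bsub>M\<^esub> x, y) \<in> carrier ?F" "free_gen R i \<in> carrier ?F"
      using add xy by (auto intro!: free_gen_closed M.R.is_cring)
    have "?c (r \<odot>\<^bsub>?F\<^esub> free_gen R i \<oplus>\<^bsub>?F\<^esub> f) = r \<odot>\<^bsub>tensor R M N\<^esub> pure_tensor R M N x y \<oplus>\<^bsub>tensor R M N\<^esub> ?c f"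
      using add(1,3) gen(2) unfolding pure_tensor_def i
      by (simp add: linear_map_add[OF lin] linear_map_smult[OF lin] del: free_module_simps)
    also have "r \<odot>\<^bsub>tensor R M N\<^esub> pure_tensor R M N x y = pure_tensor R M N (r \<odot>\<^bsub>M\<^esub> x) y"
      using add(1) xy linear_map_smult[OF bilinear_map_left[OF bilinear_map_pure_tensor[OF assms(1,2)]]] by metis
    finally show ?case
      using add xy assms(5)[of "r \<odot>\<^bsub>M\<^esub> x" y "?c f"] linear_map_closed[OF lin, of f] by (auto simp del: free_module_simps)
  qed
  then show ?thesis using f(2) by simp
qed

text \<open>The uniqueness half of the universal property. Congruence of lifts, their composition
  with linear maps and their exchange are all checked on pure tensors through it.\<close>

lemma tensor_linear_map_eqI:
  assumes "module R M" "module R N" "module R P"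
    and "linear_map R (tensor R M N) P f" "linear_map R (tensor R M N) P g"
    and eq: "\<And>x y. \<lbrakk>x \<in> carrier M; y \<in> carrier N\<rbrakk> \<Longrightarrow> f (pure_tensor R M N x y) = g (pure_tensor R M N x y)"
    and t: "t \<in> carrier (tensor R M N)"
  shows "f t = g t"
  using assms(1,2) t
proof (induction rule: tensor_induct)
  case zero
  then show ?case
    using assms by (simp add: linear_map_zero[OF module_tensor])
next
  case (add x y t)
  then show ?case
    using pure_tensor_closed[OF assms(1,2)]
    by (simp add: linear_map_add[OF assms(4)] linear_map_add[OF assms(5)] eq)
qed

text \<open>Independence of the representative. Bilinearity of \<open>B\<close> puts every relator
  into the kernel of the linear extension; the kernel is a submodule, so it contains
  \<open>tensor_null\<close>, and the extension is constant on cosets.\<close>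

lemma tensor_lift_coset:
  assumes "module R M" "module R N" "module R P" "bilinear_map R M N P B"
    and f: "f \<in> carrier (free_module R (carrier M \<times> carrier N))"
  shows "tensor_lift R M N P B (tensor_null R M N +>\<^bsub>free_module R (carrier M \<times> carrier N)\<^esub> f)
    = free_lift R P (\<lambda>p. B (fst p) (snd p)) f"
proof -
  interpret M: module R M by fact
  interpret N: module R N by fact
  interpret P: module R P by fact
  let ?I = "carrier M \<times> carrier N"
  let ?F = "free_module R ?I"
  interpret F: module R ?F by (rule module_free_module) (rule M.R.is_cring)
  let ?b = "\<lambda>p. B (fst p) (snd p)"
  let ?L = "free_lift R P ?b"
  let ?c = "tensor_null R M N +>\<^bsub>?F\<^esub> f"
  have b: "?b \<in> ?I \<rightarrow> carrier P"
    using bilinear_map_closed[OF assms(4)] by auto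
  note lin = linear_map_free_lift[OF assms(3) b]
  have gen: "free_gen R (x, y) \<in> carrier ?F" "?L (free_gen R (x, y)) = B x y"
    if "x \<in> carrier M" "y \<in> carrier N" for x y
    using that free_lift_gen[OF assms(3) b, of "(x, y)"] by (auto intro!: free_gen_closed M.R.is_cring)
  have B: "B x y \<in> carrier P" if "x \<in> carrier M" "y \<in> carrier N" for x y
    using that by (rule bilinear_map_closed[OF assms(4)])
  let ?K = "{g \<in> carrier ?F. ?L g = \<zero>\<^bsub>P\<^esub>}"
  have "tensor_relators R M N \<subseteq> ?K"
    unfolding tensor_relators_def Let_def
    by (auto simp: gen B P.r_neg a_minus_def[of P] linear_map_minus[OF F.module_axioms assms(3) lin]
        linear_map_add[OF lin] linear_map_smult[OF lin]
        linear_map_add[OF bilinear_map_left[OF assms(4)]] linear_map_add[OF bilinear_map_right[OF assms(4)]]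
        linear_map_smult[OF bilinear_map_left[OF assms(4)]] linear_map_smult[OF bilinear_map_right[OF assms(4)]]
        simp del: free_module_simps)
  then have null: "tensor_null R M N \<subseteq> ?K"
    using submodule_kernel[OF F.module_axioms assms(3) lin]
    by (auto simp: tensor_null_def submodule_span_def)
  have "?L g = ?L f" if g: "g \<in> ?c" for g
  proof -
    obtain n where n: "n \<in> tensor_null R M N" "g = n \<oplus>\<^bsub>?F\<^esub> f"
      using g by (auto simp: a_r_coset_def')
    have "n \<in> carrier ?F" "?L n = \<zero>\<^bsub>P\<^esub>"
      using n null by auto
    then show ?thesis
      using f n linear_map_closed[OF lin f] linear_map_add[OF lin] by simp
  qed
  \<comment> \<open>The coset is non-empty, so the element chosen by \<open>SOME\<close> really
    belongs to it.\<close>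
  moreover have "f \<in> ?c"
    using submodule_tensor_null[OF assms(1,2)] f
    by (intro abelian_subgroup.a_rcos_self abelian_subgroup_submodule[OF F.module_axioms])
  then have "(SOME g. g \<in> ?c) \<in> ?c"
    by (rule someI[where P = "\<lambda>g. g \<in> ?c"])
  ultimately have "?L (SOME g. g \<in> ?c) = ?L f"
    by blast
  then show ?thesis
    by (simp add: tensor_lift_def free_lift_def)
qed

lemma linear_map_tensor_lift:
  assumes "module R M" "module R N" "module R P" "bilinear_map R M N P B"
  shows "linear_map R (tensor R M N) P (tensor_lift R M N P B)"
proof -
  interpret M: module R M by fact
  let ?F = "free_module R (carrier M \<times> carrier N)"
  interpret F: module R ?F by (rule module_free_module) (rule M.R.is_cring)
  have b: "(\<lambda>p. B (fst p) (snd p)) \<in> carrier M \<times> carrier N \<rightarrow> carrier P"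
    using bilinear_map_closed[OF assms(4)] by auto
  note lin = linear_map_free_lift[OF assms(3) b]
  note coset = linear_map_tensor_coset[OF assms(1,2)]
  have carr: "\<exists>f\<in>carrier ?F. t = tensor_null R M N +>\<^bsub>?F\<^esub> f" if "t \<in> carrier (tensor R M N)" for t
    using that by (auto simp: tensor_def quotient_module_carrier)
  note [simp] = tensor_lift_coset[OF assms]
  note [simp del] = free_module_simps
  show ?thesis
    by (rule linear_mapI)
      (auto dest!: carr simp: linear_map_add[OF coset, symmetric] linear_map_smult[OF coset, symmetric]
        linear_map_closed[OF lin] linear_map_add[OF lin] linear_map_smult[OF lin])
qed

lemma tensor_lift_pure_tensor:
  assumes "module R M" "module R N" "module R P" "bilinear_map R M N P B" "x \<in> carrier M" "y \<in> carrier N"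
  shows "tensor_lift R M N P B (pure_tensor R M N x y) = B x y"
proof -
  interpret M: module R M by fact
  have b: "(\<lambda>p. B (fst p) (snd p)) \<in> carrier M \<times> carrier N \<rightarrow> carrier P"
    using bilinear_map_closed[OF assms(4)] by auto
  have "free_gen R (x, y) \<in> carrier (free_module R (carrier M \<times> carrier N))"
    using assms by (intro free_gen_closed M.R.is_cring) auto
  then show ?thesis
    using free_lift_gen[OF assms(3) b, of "(x, y)"] assms(5,6)
    by (simp add: pure_tensor_def tensor_lift_coset[OF assms(1-4)])
qed

lemma tensor_lift_linear_map:
  assumes "module R M" "module R N" "module R P" "module R Q"
    and B: "bilinear_map R M N P B" and f: "linear_map R P Q f"
    and t: "t \<in> carrier (tensor R M N)"
  shows "f (tensor_lift R M N P B t) = tensor_lift R M N Q (\<lambda>x y. f (B x y)) t"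
proof (rule tensor_linear_map_eqI[OF assms(1,2,4) _ _ _ t])
  show "linear_map R (tensor R M N) Q (\<lambda>t. f (tensor_lift R M N P B t))"
    using f linear_map_tensor_lift[OF assms(1-3) B] by (rule linear_map_compose)
  show "linear_map R (tensor R M N) Q (tensor_lift R M N Q (\<lambda>x y. f (B x y)))"
    by (rule linear_map_tensor_lift[OF assms(1,2,4) linear_map_bilinear_map[OF B f]])
qed (simp add: tensor_lift_pure_tensor[OF assms(1-3) B]
    tensor_lift_pure_tensor[OF assms(1,2,4) linear_map_bilinear_map[OF B f]])

text \<open>Bilinearity passes from \<open>B\<close> to \<open>B'\<close> because linearity only
  looks at the carriers. An equation between lifts can therefore be justified from whichever side
  has the more convenient bilinearity proof, by reversing the equation if necessary.\<close>

lemma tensor_lift_cong: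
  assumes "module R M" "module R N" "module R P" "bilinear_map R M N P B"
    and "\<And>x y. \<lbrakk>x \<in> carrier M; y \<in> carrier N\<rbrakk> \<Longrightarrow> B x y = B' x y"
    and "t \<in> carrier (tensor R M N)"
  shows "tensor_lift R M N P B t = tensor_lift R M N P B' t"
proof -
  have B': "bilinear_map R M N P B'"
  proof (rule bilinear_mapI)
    show "linear_map R N P (B' x)" if "x \<in> carrier M" for x
      using linear_map_cong[OF assms(2), of "B x" "B' x" P] assms(5) that bilinear_map_right[OF assms(4)]
      by simp
    show "linear_map R M P (\<lambda>x. B' x y)" if "y \<in> carrier N" for y
      using linear_map_cong[OF assms(1), of "\<lambda>x. B x y" "\<lambda>x. B' x y" P] assms(5) that
        bilinear_map_left[OF assms(4)]
      by simp
  qed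
  show ?thesis
    by (rule tensor_linear_map_eqI[OF assms(1-3) linear_map_tensor_lift[OF assms(1-4)]
          linear_map_tensor_lift[OF assms(1-3) B'] _ assms(6)])
      (simp add: tensor_lift_pure_tensor[OF assms(1-4)] tensor_lift_pure_tensor[OF assms(1-3) B'] assms(5))
qed

text \<open>Linearity in a parameter of the summand. It makes an iterated sum bilinear in its outer
  variables, which the exchange of two sums requires.\<close>

lemma linear_map_tensor_lift_param:
  assumes "module R M" "module R N" "module R P" "module R Q"
    and B: "\<And>x. x \<in> carrier Q \<Longrightarrow> bilinear_map R M N P (B x)"
    and lin: "\<And>y z. \<lbrakk>y \<in> carrier M; z \<in> carrier N\<rbrakk> \<Longrightarrow> linear_map R Q P (\<lambda>x. B x y z)"
    and t: "t \<in> carrier (tensor R M N)"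
  shows "linear_map R Q P (\<lambda>x. tensor_lift R M N P (B x) t)"
  using assms(1,2) t
proof (induction rule: tensor_induct)
  case zero
  interpret P: module R P by fact
  interpret Q: module R Q by fact
  have "tensor_lift R M N P (B x) \<zero>\<^bsub>tensor R M N\<^esub> = \<zero>\<^bsub>P\<^esub>" if "x \<in> carrier Q" for x
    using linear_map_tensor_lift[OF assms(1-3) B[OF that]]
    by (intro linear_map_zero[OF module_tensor] assms)
  then show ?case
    by (auto intro!: linear_mapI)
next
  case (add y z t)
  interpret P: module R P by fact
  interpret Q: module R Q by fact
  have eq: "tensor_lift R M N P (B x) (pure_tensor R M N y z \<oplus>\<^bsub>tensor R M N\<^esub> t)
      = B x y z \<oplus>\<^bsub>P\<^esub> tensor_lift R M N P (B x) t" if "x \<in> carrier Q" for x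
    using add pure_tensor_closed[OF assms(1,2)]
    by (simp add: linear_map_add[OF linear_map_tensor_lift[OF assms(1-3) B[OF that]]]
        tensor_lift_pure_tensor[OF assms(1-3) B[OF that]])
  note l = lin[OF add(1,2)]
  show ?case
    using add
    by (intro linear_mapI)
      (auto simp: eq linear_mapD[OF l] linear_mapD[OF add(4)] P.smult_r_distr P.M.a_ac)
qed

text \<open>A Fubini rule. Both sides are linear in \<open>s\<close>, and for a pure tensor
  \<open>s\<close> the lift over \<open>s\<close> is plain evaluation on either side.\<close>

lemma tensor_lift_swap:
  assumes "module R M" "module R N" "module R M'" "module R N'" "module R P"
    and B: "\<And>x y. \<lbrakk>x \<in> carrier M; y \<in> carrier N\<rbrakk> \<Longrightarrow> bilinear_map R M' N' P (B x y)"
    and B': "\<And>u v. \<lbrakk>u \<in> carrier M'; v \<in> carrier N'\<rbrakk> \<Longrightarrow> bilinear_map R M N P (\<lambda>x y. B x y u v)"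
    and s: "s \<in> carrier (tensor R M N)" and t: "t \<in> carrier (tensor R M' N')"
  shows "tensor_lift R M N P (\<lambda>x y. tensor_lift R M' N' P (B x y) t) s
    = tensor_lift R M' N' P (\<lambda>u v. tensor_lift R M N P (\<lambda>x y. B x y u v) s) t"
proof -
  have bil: "bilinear_map R M N P (\<lambda>x y. tensor_lift R M' N' P (B x y) t)"
    using t assms(1-5)
    by - (rule bilinear_mapI; rule linear_map_tensor_lift_param; auto intro: B bilinear_mapD[OF B'])
  \<comment> \<open>Stated for every \<open>s'\<close>, because the right-hand side is first shown
    to be linear in \<open>s\<close> and then evaluated at pure tensors.\<close>
  have bil': "bilinear_map R M' N' P (\<lambda>u v. tensor_lift R M N P (\<lambda>x y. B x y u v) s')"
    if "s' \<in> carrier (tensor R M N)" for s'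
    using that assms(1-5)
    by - (rule bilinear_mapI; rule linear_map_tensor_lift_param; auto intro: B' bilinear_mapD[OF B])
  show ?thesis
  proof (rule tensor_linear_map_eqI[OF assms(1,2,5) _ _ _ s])
    show "linear_map R (tensor R M N) P (tensor_lift R M N P (\<lambda>x y. tensor_lift R M' N' P (B x y) t))"
      by (intro linear_map_tensor_lift assms bil)
    show "linear_map R (tensor R M N) P
        (\<lambda>s. tensor_lift R M' N' P (\<lambda>u v. tensor_lift R M N P (\<lambda>x y. B x y u v) s) t)"
      by (intro linear_map_tensor_lift_param module_tensor assms bil' linear_map_tensor_lift B')
    fix x y assume xy: "x \<in> carrier M" "y \<in> carrier N"
    then show "tensor_lift R M N P (\<lambda>x y. tensor_lift R M' N' P (B x y) t) (pure_tensor R M N x y)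
        = tensor_lift R M' N' P (\<lambda>u v. tensor_lift R M N P (\<lambda>x y. B x y u v) (pure_tensor R M N x y)) t"
      using pure_tensor_closed[OF assms(1,2)] assms(1-5) t bil B bil' B'
      by (subst tensor_lift_pure_tensor, auto intro!: tensor_lift_cong simp: tensor_lift_pure_tensor)
  qed
qed

subsection \<open>Sweedler sums\<close>

lemma bilinear_map_comp_right:
  assumes "bilinear_map R M N P B" "x \<in> carrier M" "linear_map R Q N f"
  shows "linear_map R Q P (\<lambda>z. B x (f z))"
  using bilinear_map_right[OF assms(1,2)] assms(3) by (rule linear_map_compose)

lemma bilinear_map_comp_left:
  assumes "bilinear_map R M N P B" "y \<in> carrier N" "linear_map R Q M f"
  shows "linear_map R Q P (\<lambda>z. B (f z) y)"
  using bilinear_map_left[OF assms(1,2)] assms(3) by (rule linear_map_compose)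

lemma linear_map_ident: "linear_map R M M (\<lambda>x. x)"
  by (rule linear_mapI) simp_all

lemma (in assoc_algebra) bilinear_map_mult: "bilinear_map R A A A (\<lambda>x y. x \<otimes>\<^bsub>A\<^esub> y)"
  by (intro bilinear_mapI linear_mapI) (auto simp: smult_mult_left smult_mult_right l_distr r_distr)

lemma bilinear_map_base_mult:
  assumes "cring R"
  shows "bilinear_map R (base_module R) (base_module R) (base_module R) (\<lambda>x y. x \<otimes>\<^bsub>R\<^esub> y)"
proof -
  interpret cring R by fact
  show ?thesis
    by (intro bilinear_mapI linear_mapI) (auto simp: l_distr r_distr m_ac)
qed

lemma bilinear_map_bracket:
  assumes "pairing R V W p"
  shows "bilinear_map R V W (base_module R) (bracket R V W p)"
proof -
  have "module R V" "module R W" "linear_map R (tensor R V W) (base_module R) p"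
    using assms by (auto simp: pairing_def)
  from linear_map_bilinear_map[OF bilinear_map_pure_tensor[OF this(1,2)] this(3)] show ?thesis
    by (simp add: bracket_def[abs_def])
qed

context coalgebra
begin

lemma comult_closed: "c \<in> carrier C \<Longrightarrow> comult C c \<in> carrier (tensor R C C)"
  using comult_linear by (rule linear_map_closed)

lemma linear_map_sweedler:
  assumes "module R P" "bilinear_map R C C P B"
  shows "linear_map R C P (sweedler R C P B)"
  unfolding sweedler_def[abs_def]
  by (intro linear_map_compose[OF _ comult_linear] linear_map_tensor_lift module_axioms assms)

lemma sweedler_closed:
  assumes "module R P" "bilinear_map R C C P B" "c \<in> carrier C"
  shows "sweedler R C P B c \<in> carrier P"
  using linear_map_sweedler[OF assms(1,2)] assms(3) by (rule linear_map_closed)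

lemma linear_map_sweedler_comp:
  assumes "module R P" "bilinear_map R C C P B" "linear_map R M C f"
  shows "linear_map R M P (\<lambda>x. sweedler R C P B (f x))"
  using linear_map_sweedler[OF assms(1,2)] assms(3) by (rule linear_map_compose)

lemma linear_map_sweedler_param:
  assumes "module R P" "module R M" "c \<in> carrier C"
    and "\<And>x. x \<in> carrier M \<Longrightarrow> bilinear_map R C C P (B x)"
    and "\<And>y z. \<lbrakk>y \<in> carrier C; z \<in> carrier C\<rbrakk> \<Longrightarrow> linear_map R M P (\<lambda>x. B x y z)"
  shows "linear_map R M P (\<lambda>x. sweedler R C P (B x) c)"
  unfolding sweedler_def
  by (intro linear_map_tensor_lift_param module_axioms assms comult_closed)

lemma sweedler_cong:
  assumes "module R P" "bilinear_map R C C P B" "c \<in> carrier C"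
    and "\<And>x y. \<lbrakk>x \<in> carrier C; y \<in> carrier C\<rbrakk> \<Longrightarrow> B x y = B' x y"
  shows "sweedler R C P B c = sweedler R C P B' c"
  unfolding sweedler_def
  by (rule tensor_lift_cong[OF module_axioms module_axioms assms(1,2,4) comult_closed[OF assms(3)]])

lemma linear_map_sweedler_eq:
  assumes "module R P" "module R Q" "bilinear_map R C C P B" "linear_map R P Q f" "c \<in> carrier C"
  shows "f (sweedler R C P B c) = sweedler R C Q (\<lambda>x y. f (B x y)) c"
  unfolding sweedler_def
  by (rule tensor_lift_linear_map[OF module_axioms module_axioms assms(1-4) comult_closed[OF assms(5)]])

end

text \<open>Exchange of the two independent coproducts that meet in the bracket calculations, one
  from each side of the pairing.\<close>

lemma sweedler_swap:
  assumes "coalgebra R C" "coalgebra R D" "module R P"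
    and "\<And>x y. \<lbrakk>x \<in> carrier C; y \<in> carrier C\<rbrakk> \<Longrightarrow> bilinear_map R D D P (B x y)"
    and "\<And>u v. \<lbrakk>u \<in> carrier D; v \<in> carrier D\<rbrakk> \<Longrightarrow> bilinear_map R C C P (\<lambda>x y. B x y u v)"
    and "c \<in> carrier C" "d \<in> carrier D"
  shows "sweedler R C P (\<lambda>x y. sweedler R D P (B x y) d) c
    = sweedler R D P (\<lambda>u v. sweedler R C P (\<lambda>x y. B x y u v) c) d"
proof -
  interpret C: coalgebra R C by fact
  interpret D: coalgebra R D by fact
  show ?thesis
    unfolding sweedler_def
    by (rule tensor_lift_swap[OF C.module_axioms C.module_axioms D.module_axioms D.module_axioms assms(3-5)
          C.comult_closed[OF assms(6)] D.comult_closed[OF assms(7)]])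
qed

subsection \<open>Separation of tensors over a field\<close>

text \<open>The tensors of rank at most \<open>n\<close>, as summands may be zero. The number of
  summands is the induction measure for the separation of tensors.\<close>

primrec tensor_sums ::
  "('k, 'r) ring_scheme \<Rightarrow> ('k, 'm, 'x) module_scheme \<Rightarrow> ('k, 'n, 'y) module_scheme
    \<Rightarrow> nat \<Rightarrow> ('m \<times> 'n \<Rightarrow> 'k) set set"
  where
    "tensor_sums R M N 0 = {\<zero>\<^bsub>tensor R M N\<^esub>}"
  | "tensor_sums R M N (Suc n) = {pure_tensor R M N x y \<oplus>\<^bsub>tensor R M N\<^esub> t | x y t.
      x \<in> carrier M \<and> y \<in> carrier N \<and> t \<in> tensor_sums R M N n}"

lemma tensor_sums_closed:
  assumes "module R M" "module R N" "t \<in> tensor_sums R M N n"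
  shows "t \<in> carrier (tensor R M N)"
proof -
  interpret T: module R "tensor R M N" by (rule module_tensor[OF assms(1,2)])
  show ?thesis
    using assms(3) by (induction n arbitrary: t) (auto simp: pure_tensor_closed[OF assms(1,2)])
qed

lemma ex_tensor_sums:
  assumes "module R M" "module R N" "t \<in> carrier (tensor R M N)"
  shows "\<exists>n. t \<in> tensor_sums R M N n"
  using assms
proof (induction rule: tensor_induct)
  case zero
  show ?case by (rule exI[of _ 0]) simp
next
  case (add x y t)
  then obtain n where "t \<in> tensor_sums R M N n" by blast
  then have "pure_tensor R M N x y \<oplus>\<^bsub>tensor R M N\<^esub> t \<in> tensor_sums R M N (Suc n)"
    using add by auto
  then show ?case by blast
qed

text \<open>A linear map that sends pure tensors to pure tensors acts on a sum term by term and so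
  does not lengthen it.\<close>

lemma linear_map_tensor_sums:
  assumes "module R M" "module R N" "module R M'" "module R N'"
    and lin: "linear_map R (tensor R M N) (tensor R M' N') L"
    and pure: "\<And>x y. \<lbrakk>x \<in> carrier M; y \<in> carrier N\<rbrakk>
      \<Longrightarrow> \<exists>x'\<in>carrier M'. \<exists>y'\<in>carrier N'. L (pure_tensor R M N x y) = pure_tensor R M' N' x' y'"
    and "t \<in> tensor_sums R M N n"
  shows "L t \<in> tensor_sums R M' N' n"
  using assms(7)
proof (induction n arbitrary: t)
  case 0
  then show ?case
    using assms(1-4) linear_map_zero[OF _ _ lin] by (simp add: module_tensor)
next
  case (Suc n)
  then obtain x y s where s: "x \<in> carrier M" "y \<in> carrier N" "s \<in> tensor_sums R M N n"
    "t = pure_tensor R M N x y \<oplus>\<^bsub>tensor R M N\<^esub> s"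
    by auto
  then have "L t = L (pure_tensor R M N x y) \<oplus>\<^bsub>tensor R M' N'\<^esub> L s"
    using tensor_sums_closed[OF assms(1,2)] pure_tensor_closed[OF assms(1,2)]
    by (simp add: linear_map_add[OF lin])
  then show ?case
    using pure[OF s(1,2)] Suc.IH[OF s(3)] by fastforce
qed

lemma (in module) bilinear_map_smult: "bilinear_map R (base_module R) M M (\<lambda>r x. r \<odot>\<^bsub>M\<^esub> x)"
  by (intro bilinear_mapI linear_mapI)
    (auto simp: smult_l_distr smult_r_distr smult_assoc1[symmetric] R.m_comm)

text \<open>Over a field, an element of \<open>V \<otimes> N\<close> is determined by its contractions with the functionals
  \<open>\<langle>-, w\<rangle>\<close>: if \<open>u \<otimes> v + s\<close> is contracted to zero by a functional with value \<open>a \<noteq> 0\<close> on \<open>u\<close>, then \<open>v\<close>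
  is \<open>- a\<inverse>\<close> times the contraction of \<open>s\<close>, so that \<open>u \<otimes> v + s\<close> is the image of \<open>s\<close> under a map
  \<open>f \<otimes> id\<close> and needs one pure tensor less.\<close>

lemma contraction_zero_imp_zero:
  assumes "field R" "pairing R V W p" "left_nondegenerate R V W p" "module R N"
    and "t \<in> carrier (tensor R V N)"
    and "\<And>w. w \<in> carrier W \<Longrightarrow>
      tensor_lift R V N N (\<lambda>u v. bracket R V W p u w \<odot>\<^bsub>N\<^esub> v) t = \<zero>\<^bsub>N\<^esub>"
  shows "t = \<zero>\<^bsub>tensor R V N\<^esub>"
proof -
  interpret field R by fact
  have V: "module R V" using assms(2) by (simp add: pairing_def)
  interpret V: module R V by (rule V)
  interpret N: module R N by fact
  let ?T = "tensor R V N"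
  let ?b = "bracket R V W p"
  let ?pt = "pure_tensor R V N"
  interpret T: module R ?T by (rule module_tensor[OF V assms(4)])
  note VN = V assms(4)
  note b = bilinear_map_bracket[OF assms(2)]
  have b_closed: "?b u w \<in> carrier R" if "u \<in> carrier V" "w \<in> carrier W" for u w
    using bilinear_map_closed[OF b that] by simp
  note pt = bilinear_map_pure_tensor[OF VN]
  define G where "G w = tensor_lift R V N N (\<lambda>u v. ?b u w \<odot>\<^bsub>N\<^esub> v)" for w
  have bil: "bilinear_map R V N N (\<lambda>u v. ?b u w \<odot>\<^bsub>N\<^esub> v)" if "w \<in> carrier W" for w
    using that b_closed
    by (intro bilinear_mapI bilinear_map_comp_left[OF N.bilinear_map_smult]
        bilinear_map_right[OF N.bilinear_map_smult] bilinear_map_left[OF b]) auto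
  have G_lin: "linear_map R ?T N (G w)" if "w \<in> carrier W" for w
    unfolding G_def by (rule linear_map_tensor_lift[OF VN assms(4) bil[OF that]])
  have G_pure: "G w (?pt u v) = ?b u w \<odot>\<^bsub>N\<^esub> v" if "w \<in> carrier W" "u \<in> carrier V" "v \<in> carrier N" for w u v
    unfolding G_def by (rule tensor_lift_pure_tensor[OF VN assms(4) bil[OF that(1)] that(2,3)])
  \<comment> \<open>The tensor stays arbitrary in the induction on \<open>n\<close>, because the
    induction hypothesis is applied both to the remainder \<open>s\<close> and to its image
    \<open>L s\<close>.\<close>
  have "t \<in> tensor_sums R V N n \<Longrightarrow> (\<And>w. w \<in> carrier W \<Longrightarrow> G w t = \<zero>\<^bsub>N\<^esub>) \<Longrightarrow> t = \<zero>\<^bsub>?T\<^esub>" for t n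
  proof (induction n arbitrary: t)
    case 0
    then show ?case by simp
  next
    case (Suc n)
    then obtain u v s where s: "u \<in> carrier V" "v \<in> carrier N" "s \<in> tensor_sums R V N n"
      and t: "t = ?pt u v \<oplus>\<^bsub>?T\<^esub> s"
      by auto
    have s': "s \<in> carrier ?T" using tensor_sums_closed[OF VN s(3)] .
    show ?case
    proof (cases "\<forall>w\<in>carrier W. ?b u w = \<zero>\<^bsub>R\<^esub>")
      case True
      then have "u = \<zero>\<^bsub>V\<^esub>"
        using assms(3) s(1) by (auto simp: left_nondegenerate_def)
      then have "?pt u v = \<zero>\<^bsub>?T\<^esub>"
        using linear_map_zero[OF V T.module_axioms bilinear_map_left[OF pt s(2)]] by simp
      then have "t = s"
        using t s' by simp
      then show ?thesis
        using Suc s(3) by blast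
    next
      case False
      then obtain w where w: "w \<in> carrier W" "?b u w \<noteq> \<zero>\<^bsub>R\<^esub>" by blast
      define c where "c = \<ominus>\<^bsub>R\<^esub> (inv\<^bsub>R\<^esub> (?b u w))"
      have unit: "?b u w \<in> Units R"
        using w b_closed[OF s(1) w(1)] by (simp add: field_Units)
      then have c: "c \<in> carrier R" "c \<otimes>\<^bsub>R\<^esub> ?b u w = \<ominus>\<^bsub>R\<^esub> \<one>\<^bsub>R\<^esub>"
        using b_closed[OF s(1) w(1)] by (simp_all add: c_def l_minus)
      have Gs: "G w s \<in> carrier N"
        using G_lin[OF w(1)] s' by (rule linear_map_closed)
      have "\<zero>\<^bsub>N\<^esub> = c \<odot>\<^bsub>N\<^esub> G w t"
        using Suc.prems(2)[OF w(1)] c(1) by simp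
      also have "G w t = ?b u w \<odot>\<^bsub>N\<^esub> v \<oplus>\<^bsub>N\<^esub> G w s"
        using s s' w(1) pure_tensor_closed[OF VN s(1,2)]
        by (simp add: t linear_map_add[OF G_lin] G_pure)
      also have "c \<odot>\<^bsub>N\<^esub> \<dots> = \<ominus>\<^bsub>N\<^esub> v \<oplus>\<^bsub>N\<^esub> c \<odot>\<^bsub>N\<^esub> G w s"
        using c s(2) b_closed[OF s(1) w(1)] Gs
        by (simp add: N.smult_r_distr N.smult_assoc1[symmetric] N.smult_l_minus)
      finally have v: "v = c \<odot>\<^bsub>N\<^esub> G w s"
        using s(2) c(1) Gs
        by (metis N.M.a_inv_closed N.M.add.inv_equality N.M.minus_minus N.smult_closed)
      \<comment> \<open>As \<open>c\<close> times the bracket of \<open>u\<close> with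
        \<open>w\<close> is -1, this is the projection along \<open>u\<close> onto the kernel of the
        bracket with \<open>w\<close>. The next definition is \<open>f \<otimes> id\<close> written
        without splitting its argument into pure tensors, so that its linearity comes from that of
        \<open>G w\<close>.\<close>
      define f where "f x = x \<oplus>\<^bsub>V\<^esub> (c \<otimes>\<^bsub>R\<^esub> ?b x w) \<odot>\<^bsub>V\<^esub> u" for x
      define L where "L s = s \<oplus>\<^bsub>?T\<^esub> ?pt u (c \<odot>\<^bsub>N\<^esub> G w s)" for s
      note G_w = G_lin[OF w(1)]
      note pt_u = bilinear_map_right[OF pt s(1)]
      have L_lin: "linear_map R ?T ?T L"
        unfolding L_def[abs_def] using c(1)
        by (intro linear_mapI)
          (auto simp: linear_mapD[OF G_w] linear_mapD[OF pt_u] N.smult_r_distr T.smult_r_distr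
            N.smult_assoc1[symmetric] T.smult_assoc1[symmetric] m_comm T.M.a_ac)
      have "L (?pt x y) = ?pt (f x) y" "f x \<in> carrier V" if "x \<in> carrier V" "y \<in> carrier N" for x y
      proof -
        have "?pt u (c \<odot>\<^bsub>N\<^esub> (?b x w \<odot>\<^bsub>N\<^esub> y)) = (c \<otimes>\<^bsub>R\<^esub> ?b x w) \<odot>\<^bsub>?T\<^esub> ?pt u y"
          using that c(1) b_closed[OF that(1) w(1)]
          by (simp add: N.smult_assoc1[symmetric] linear_map_smult[OF pt_u])
        also have "\<dots> = ?pt ((c \<otimes>\<^bsub>R\<^esub> ?b x w) \<odot>\<^bsub>V\<^esub> u) y"
          using that c(1) s(1) b_closed[OF that(1) w(1)]
          by (simp add: linear_map_smult[OF bilinear_map_left[OF pt that(2)]])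
        finally show "L (?pt x y) = ?pt (f x) y"
          using that c(1) s(1) w(1) b_closed[OF that(1) w(1)]
          by (simp add: L_def f_def G_pure linear_map_add[OF bilinear_map_left[OF pt that(2)]])
        show "f x \<in> carrier V"
          using that c(1) s(1) b_closed[OF that(1) w(1)] by (simp add: f_def)
      qed
      then have "L s \<in> tensor_sums R V N n"
        by (intro linear_map_tensor_sums[OF VN VN L_lin _ s(3)]) blast
      \<comment> \<open>By the formula for \<open>v\<close>, the correction term in
        \<open>L s\<close> is exactly the pure tensor of \<open>u\<close> and
        \<open>v\<close>.\<close>
      moreover have "t = L s"
        using s' pure_tensor_closed[OF VN s(1,2)] by (simp add: t L_def v[symmetric] T.M.a_comm)
      ultimately show ?thesis
        using Suc by blast
    qed
  qed
  then show ?thesis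
    using ex_tensor_sums[OF VN assms(5)] assms(6) unfolding G_def by blast
qed

text \<open>The two factors are treated in succession. The bracket of the contraction by
  \<open>w\<close> with \<open>w'\<close> is the given double bracket, so the contraction vanishes
  by non-degeneracy of the second pairing; the first pairing then gives \<open>t\<close>.\<close>

lemma tensor_brackets_zero_imp_zero:
  assumes "field R" "pairing R V W p" "left_nondegenerate R V W p"
    and "pairing R V' W' p'" "left_nondegenerate R V' W' p'"
    and t: "t \<in> carrier (tensor R V V')"
    and zero: "\<And>w w'. \<lbrakk>w \<in> carrier W; w' \<in> carrier W'\<rbrakk> \<Longrightarrow> tensor_lift R V V' (base_module R)
      (\<lambda>u v. bracket R V W p u w \<otimes>\<^bsub>R\<^esub> bracket R V' W' p' v w') t = \<zero>\<^bsub>R\<^esub>"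
  shows "t = \<zero>\<^bsub>tensor R V V'\<^esub>"
proof (rule contraction_zero_imp_zero[OF assms(1-3) _ t])
  have V: "module R V" and V': "module R V'"
    using assms(2,4) by (simp_all add: pairing_def)
  interpret V: module R V by (rule V)
  interpret V': module R V' by (rule V')
  note k = module_base_module[OF V.R.is_cring]
  show "module R V'" by (rule V')
  note b = bilinear_map_bracket[OF assms(2)] and b' = bilinear_map_bracket[OF assms(4)]
  fix w assume w: "w \<in> carrier W"
  have b_closed: "bracket R V W p u w \<in> carrier R" if "u \<in> carrier V" for u
    using bilinear_map_closed[OF b that w] by simp
  have bil: "bilinear_map R V V' V' (\<lambda>u v. bracket R V W p u w \<odot>\<^bsub>V'\<^esub> v)"
    using w b_closed
    by (intro bilinear_mapI bilinear_map_comp_left[OF V'.bilinear_map_smult]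
        bilinear_map_right[OF V'.bilinear_map_smult] bilinear_map_left[OF b]) auto
  let ?y = "tensor_lift R V V' V' (\<lambda>u v. bracket R V W p u w \<odot>\<^bsub>V'\<^esub> v) t"
  have y: "?y \<in> carrier V'"
    using linear_map_tensor_lift[OF V V' V' bil] t by (rule linear_map_closed)
  have "bracket R V' W' p' ?y w' = \<zero>\<^bsub>R\<^esub>" if w': "w' \<in> carrier W'" for w'
  proof -
    note lin = bilinear_map_left[OF b' w']
    have "bracket R V' W' p' ?y w' = tensor_lift R V V' (base_module R)
        (\<lambda>u v. bracket R V' W' p' (bracket R V W p u w \<odot>\<^bsub>V'\<^esub> v) w') t"
      by (rule tensor_lift_linear_map[OF V V' V' k bil lin t])
    also have "\<dots> = tensor_lift R V V' (base_module R)
        (\<lambda>u v. bracket R V W p u w \<otimes>\<^bsub>R\<^esub> bracket R V' W' p' v w') t"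
      using linear_map_smult[OF lin] b_closed
      by (intro tensor_lift_cong[OF V V' k linear_map_bilinear_map[OF bil lin] _ t]) simp
    finally show ?thesis using zero[OF w w'] by simp
  qed
  then show "?y = \<zero>\<^bsub>V'\<^esub>"
    using assms(5) y by (auto simp: left_nondegenerate_def)
qed

subsection \<open>Partial representations and corepresentations\<close>

text \<open>The setting common to both directions. The evaluation formulas obtained here translate
  between the two kinds of identities, and each direction only adds its own cancellation.\<close>

locale pairing_of_maps =
  HK: hopf_pairing R H K q + CA: coalgebra_algebra_pairing R C A p
  for R :: "('k, 'r) ring_scheme"
    and H :: "('k, 'h, 'x) hopf_scheme" and K :: "('k, 'l, 'y) hopf_scheme"
    and C :: "('k, 'c, 'u) coalg_scheme" and A :: "('k, 'a, 'v) module_scheme"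
    and q :: "('h \<times> 'l \<Rightarrow> 'k) set \<Rightarrow> 'k" and p :: "('c \<times> 'a \<Rightarrow> 'k) set \<Rightarrow> 'k" +
  fixes \<omega> :: "'c \<Rightarrow> 'h" and \<pi> :: "'l \<Rightarrow> 'a"
  assumes morphism: "pairing_morphism R C A p H K q \<omega> \<pi>"
begin

abbreviation "\<beta> \<equiv> bracket R H K q"
abbreviation "\<gamma> \<equiv> bracket R C A p"
abbreviation "k \<equiv> base_module R"
abbreviation "SH \<equiv> antipode H"
abbreviation "SK \<equiv> antipode K"
abbreviation "T \<equiv> tensor R H H"

lemma \<omega>_linear: "linear_map R C H \<omega>" and \<pi>_linear: "linear_map R K A \<pi>"
  and adjoint: "\<lbrakk>c \<in> carrier C; x \<in> carrier K\<rbrakk> \<Longrightarrow> \<gamma> c (\<pi> x) = \<beta> (\<omega> c) x"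
  using morphism by (auto simp: pairing_morphism_def)

lemma modules: "module R H" "module R K" "module R C" "module R A" "module R k" "module R T"
  using HK.H.module_axioms HK.K.module_axioms CA.C.module_axioms CA.A.module_axioms
    module_base_module[OF HK.H.R.is_cring] module_tensor by auto

lemmas linear_comps = linear_map_compose[OF \<omega>_linear] linear_map_compose[OF \<pi>_linear]
  linear_map_compose[OF HK.H.antipode_linear] linear_map_compose[OF HK.K.antipode_linear]

lemmas bilinear_maps = HK.H.bilinear_map_mult HK.K.bilinear_map_mult CA.A.bilinear_map_mult
  bilinear_map_base_mult[OF HK.H.R.is_cring] bilinear_map_bracket[OF HK.pairing]
  bilinear_map_bracket[OF CA.pairing] bilinear_map_pure_tensor[OF modules(1,1)]

text \<open>Rules that discharge the bilinearity conditions of Sweedler sums. They follow a variable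
  down through an expression: into either argument of a bilinear operation, into the element whose
  coproduct is taken, or into the summand of a Sweedler sum.\<close>

lemmas linear_intros = linear_map_ident linear_comps
  bilinear_maps[THEN bilinear_map_comp_left] bilinear_maps[THEN bilinear_map_comp_right]
  HK.H.linear_map_sweedler_comp HK.K.linear_map_sweedler_comp CA.C.linear_map_sweedler_comp
  HK.H.linear_map_sweedler_param HK.K.linear_map_sweedler_param CA.C.linear_map_sweedler_param

lemmas maps_closed [simp] = linear_map_closed[OF \<omega>_linear] linear_map_closed[OF \<pi>_linear]
  linear_map_closed[OF HK.H.antipode_linear] linear_map_closed[OF HK.K.antipode_linear]
  bilinear_maps[THEN bilinear_map_closed, simplified]

section \<open>Products and convolutions under the pairing\<close>

lemma \<gamma>_mult:
  assumes "c \<in> carrier C" "x \<in> carrier K" "y \<in> carrier K"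
  shows "\<gamma> c (\<pi> x \<otimes>\<^bsub>A\<^esub> \<pi> y) = sweedler R C k (\<lambda>c1 c2. \<beta> (\<omega> c1) x \<otimes>\<^bsub>R\<^esub> \<beta> (\<omega> c2) y) c"
proof -
  have "\<gamma> c (\<pi> x \<otimes>\<^bsub>A\<^esub> \<pi> y) = sweedler R C k (\<lambda>c1 c2. \<gamma> c1 (\<pi> x) \<otimes>\<^bsub>R\<^esub> \<gamma> c2 (\<pi> y)) c"
    using assms by (simp add: CA.bracket_mult_right)
  also have "\<dots> = sweedler R C k (\<lambda>c1 c2. \<beta> (\<omega> c1) x \<otimes>\<^bsub>R\<^esub> \<beta> (\<omega> c2) y) c"
    using assms
    by (intro CA.C.sweedler_cong modules bilinear_mapI linear_intros) (simp_all add: adjoint)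
  finally show ?thesis .
qed

lemma \<gamma>_mult_antipode:
  assumes "c \<in> carrier C" "x \<in> carrier K" "y \<in> carrier K"
  shows "\<gamma> c (\<pi> x \<otimes>\<^bsub>A\<^esub> \<pi> (SK y)) = sweedler R C k (\<lambda>c1 c2. \<beta> (\<omega> c1) x \<otimes>\<^bsub>R\<^esub> \<beta> (SH (\<omega> c2)) y) c"
proof -
  have "\<gamma> c (\<pi> x \<otimes>\<^bsub>A\<^esub> \<pi> (SK y)) = sweedler R C k (\<lambda>c1 c2. \<beta> (\<omega> c1) x \<otimes>\<^bsub>R\<^esub> \<beta> (\<omega> c2) (SK y)) c"
    using assms by (simp add: \<gamma>_mult)
  also have "\<dots> = sweedler R C k (\<lambda>c1 c2. \<beta> (\<omega> c1) x \<otimes>\<^bsub>R\<^esub> \<beta> (SH (\<omega> c2)) y) c"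
    using assms
    by (intro CA.C.sweedler_cong modules bilinear_mapI linear_intros) (simp_all add: HK.bracket_antipode)
  finally show ?thesis .
qed

text \<open>The convolution product of \<open>\<pi>\<close> and \<open>\<pi> \<circ> SK\<close>;
  \<open>convH\<close> is that of \<open>\<omega>\<close> and \<open>SH \<circ> \<omega>\<close>.
  They name the inner sums of the first pair of identities.\<close>

definition convA :: "'l \<Rightarrow> 'a"
  where "convA l = sweedler R K A (\<lambda>l1 l2. \<pi> l1 \<otimes>\<^bsub>A\<^esub> \<pi> (SK l2)) l"

definition convH :: "'c \<Rightarrow> 'h"
  where "convH c = sweedler R C H (\<lambda>c1 c2. \<omega> c1 \<otimes>\<^bsub>H\<^esub> SH (\<omega> c2)) c"

lemma convA_bilinear: "bilinear_map R K K A (\<lambda>l1 l2. \<pi> l1 \<otimes>\<^bsub>A\<^esub> \<pi> (SK l2))"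
  by (intro bilinear_mapI linear_intros) simp_all

lemma convH_bilinear: "bilinear_map R C C H (\<lambda>c1 c2. \<omega> c1 \<otimes>\<^bsub>H\<^esub> SH (\<omega> c2))"
  by (intro bilinear_mapI linear_intros) simp_all

lemma convA_closed [simp]: "l \<in> carrier K \<Longrightarrow> convA l \<in> carrier A"
  unfolding convA_def by (intro HK.K.sweedler_closed modules convA_bilinear)

lemma convH_closed [simp]: "c \<in> carrier C \<Longrightarrow> convH c \<in> carrier H"
  unfolding convH_def by (intro CA.C.sweedler_closed modules convH_bilinear)

lemma convH_linear: "linear_map R C H convH"
  unfolding convH_def[abs_def] by (intro CA.C.linear_map_sweedler modules convH_bilinear)

text \<open>Convolution is compatible with adjunction: the product in \<open>A\<close> becomes a sum
  over the coproduct of \<open>c\<close>, and after the exchange the sum over the coproduct of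
  \<open>l\<close> is the bracket of a product in \<open>H\<close>.\<close>

lemma \<gamma>_convA:
  assumes "c \<in> carrier C" "l \<in> carrier K"
  shows "\<gamma> c (convA l) = \<beta> (convH c) l"
proof -
  have "\<gamma> c (convA l) = sweedler R K k (\<lambda>l1 l2. \<gamma> c (\<pi> l1 \<otimes>\<^bsub>A\<^esub> \<pi> (SK l2))) l"
    unfolding convA_def using assms
    by (intro HK.K.linear_map_sweedler_eq modules convA_bilinear linear_intros)
  also have "\<dots> = sweedler R K k (\<lambda>l1 l2. sweedler R C k
      (\<lambda>c1 c2. \<beta> (\<omega> c1) l1 \<otimes>\<^bsub>R\<^esub> \<beta> (SH (\<omega> c2)) l2) c) l"
    using assms
    by (intro HK.K.sweedler_cong modules bilinear_mapI linear_intros)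
      (simp_all add: \<gamma>_mult_antipode)
  also have "\<dots> = sweedler R C k (\<lambda>c1 c2. sweedler R K k
      (\<lambda>l1 l2. \<beta> (\<omega> c1) l1 \<otimes>\<^bsub>R\<^esub> \<beta> (SH (\<omega> c2)) l2) l) c"
    using assms
    by (intro sweedler_swap HK.K.coalgebra_axioms CA.C.coalgebra_axioms modules bilinear_mapI linear_intros)
      simp_all
  also have "\<dots> = sweedler R C k (\<lambda>c1 c2. \<beta> (\<omega> c1 \<otimes>\<^bsub>H\<^esub> SH (\<omega> c2)) l) c"
    using assms
    by (intro CA.C.sweedler_cong modules bilinear_mapI linear_intros)
      (simp_all add: HK.bracket_mult_left)
  also have "\<dots> = \<beta> (convH c) l"
    unfolding convH_def using assms
    by (intro CA.C.linear_map_sweedler_eq[symmetric] modules convH_bilinear linear_intros)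
  finally show ?thesis .
qed

section \<open>Values of the functionals on \<open>H \<otimes> H\<close> at both corepresentation
  identities\<close>

definition \<Phi> :: "'l \<Rightarrow> 'l \<Rightarrow> ('h \<times> 'h \<Rightarrow> 'k) set \<Rightarrow> 'k"
  where "\<Phi> h l = tensor_lift R H H k (\<lambda>u v. \<beta> u h \<otimes>\<^bsub>R\<^esub> \<beta> v l)"

lemma
  assumes "h \<in> carrier K" "l \<in> carrier K"
  shows \<Phi>_linear: "linear_map R T k (\<Phi> h l)"
    and \<Phi>_pure_tensor: "\<lbrakk>u \<in> carrier H; v \<in> carrier H\<rbrakk>
      \<Longrightarrow> \<Phi> h l (pure_tensor R H H u v) = \<beta> u h \<otimes>\<^bsub>R\<^esub> \<beta> v l"
proof -
  have bil: "bilinear_map R H H k (\<lambda>u v. \<beta> u h \<otimes>\<^bsub>R\<^esub> \<beta> v l)"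
    using assms by (intro bilinear_mapI linear_intros) simp_all
  show "linear_map R T k (\<Phi> h l)"
    unfolding \<Phi>_def by (intro linear_map_tensor_lift modules bil)
  show "\<Phi> h l (pure_tensor R H H u v) = \<beta> u h \<otimes>\<^bsub>R\<^esub> \<beta> v l" if "u \<in> carrier H" "v \<in> carrier H"
    unfolding \<Phi>_def using that by (intro tensor_lift_pure_tensor modules bil)
qed

text \<open>\<open>sweedler3\<close> splits the second leg, and here the second and third legs are
  the ones that get multiplied. The inner sum is therefore \<open>convH w\<close>, and only a double
  sum remains.\<close>

lemma \<Phi>_corep1_right:
  assumes "c \<in> carrier C" "h \<in> carrier K" "l \<in> carrier K"
  shows "\<Phi> h l (sweedler3 R C T (\<lambda>c1 c2 c3. pure_tensor R H H (\<omega> c1) (\<omega> c2 \<otimes>\<^bsub>H\<^esub> SH (\<omega> c3))) c)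
    = \<gamma> c (sweedler R K A (\<lambda>l1 l2. \<pi> h \<otimes>\<^bsub>A\<^esub> \<pi> l1 \<otimes>\<^bsub>A\<^esub> \<pi> (SK l2)) l)"
proof -
  have "sweedler3 R C T (\<lambda>c1 c2 c3. pure_tensor R H H (\<omega> c1) (\<omega> c2 \<otimes>\<^bsub>H\<^esub> SH (\<omega> c3))) c
      = sweedler R C T (\<lambda>c1 w. pure_tensor R H H (\<omega> c1) (convH w)) c"
    unfolding sweedler3_def
  proof (rule CA.C.sweedler_cong[OF modules(6) _ assms(1), symmetric])
    fix x w assume "x \<in> carrier C" "w \<in> carrier C"
    then show "pure_tensor R H H (\<omega> x) (convH w)
        = sweedler R C T (\<lambda>y z. pure_tensor R H H (\<omega> x) (\<omega> y \<otimes>\<^bsub>H\<^esub> SH (\<omega> z))) w"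
      unfolding convH_def
      by (intro CA.C.linear_map_sweedler_eq modules convH_bilinear linear_intros) simp_all
  qed (intro bilinear_mapI linear_intros convH_linear; simp)
  then have "\<Phi> h l (sweedler3 R C T (\<lambda>c1 c2 c3. pure_tensor R H H (\<omega> c1) (\<omega> c2 \<otimes>\<^bsub>H\<^esub> SH (\<omega> c3))) c)
      = \<Phi> h l (sweedler R C T (\<lambda>c1 w. pure_tensor R H H (\<omega> c1) (convH w)) c)"
    by simp
  also have "\<dots> = sweedler R C k (\<lambda>c1 w. \<Phi> h l (pure_tensor R H H (\<omega> c1) (convH w))) c"
    using assms
    by (intro CA.C.linear_map_sweedler_eq modules bilinear_mapI linear_intros convH_linear \<Phi>_linear) simp_all
  also have "\<dots> = sweedler R C k (\<lambda>c1 w. \<gamma> c1 (\<pi> h) \<otimes>\<^bsub>R\<^esub> \<gamma> w (convA l)) c"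
    using assms
    by (intro CA.C.sweedler_cong[symmetric] modules bilinear_mapI linear_intros)
      (simp_all add: \<Phi>_pure_tensor adjoint \<gamma>_convA)
  also have "\<dots> = \<gamma> c (\<pi> h \<otimes>\<^bsub>A\<^esub> convA l)"
    using assms by (simp add: CA.bracket_mult_right)
  also have "\<pi> h \<otimes>\<^bsub>A\<^esub> convA l = sweedler R K A (\<lambda>l1 l2. \<pi> h \<otimes>\<^bsub>A\<^esub> (\<pi> l1 \<otimes>\<^bsub>A\<^esub> \<pi> (SK l2))) l"
    unfolding convA_def using assms
    by (intro HK.K.linear_map_sweedler_eq modules convA_bilinear linear_intros) simp_all
  also have "\<dots> = sweedler R K A (\<lambda>l1 l2. \<pi> h \<otimes>\<^bsub>A\<^esub> \<pi> l1 \<otimes>\<^bsub>A\<^esub> \<pi> (SK l2)) l"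
    using assms
    by (intro HK.K.sweedler_cong modules bilinear_mapI linear_intros) (simp_all add: CA.A.m_assoc)
  finally show ?thesis .
qed

text \<open>Expanding the product of \<open>v\<close> and \<open>g\<close> splits \<open>l\<close>;
  after the exchange, the sum over the coproduct of \<open>x\<close> is the expansion of a product
  in \<open>K\<close>. With \<open>x\<close> equal to \<open>\<omega> c1\<close> this trades a
  coproduct in \<open>H\<close> for a product inside \<open>\<pi>\<close>.\<close>

lemma sweedler_mult_left:
  assumes "x \<in> carrier H" "g \<in> carrier H" "h \<in> carrier K" "l \<in> carrier K"
  shows "sweedler R H k (\<lambda>u v. \<beta> u h \<otimes>\<^bsub>R\<^esub> \<beta> (v \<otimes>\<^bsub>H\<^esub> g) l) x
    = sweedler R K k (\<lambda>l1 l2. \<beta> x (h \<otimes>\<^bsub>K\<^esub> l1) \<otimes>\<^bsub>R\<^esub> \<beta> g l2) l"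
proof -
  have "sweedler R H k (\<lambda>u v. \<beta> u h \<otimes>\<^bsub>R\<^esub> \<beta> (v \<otimes>\<^bsub>H\<^esub> g) l) x
      = sweedler R H k (\<lambda>u v. sweedler R K k (\<lambda>l1 l2. (\<beta> u h \<otimes>\<^bsub>R\<^esub> \<beta> v l1) \<otimes>\<^bsub>R\<^esub> \<beta> g l2) l) x"
  proof (rule HK.H.sweedler_cong[OF modules(5) _ assms(1)])
    fix u v assume uv: "u \<in> carrier H" "v \<in> carrier H"
    then have "\<beta> u h \<otimes>\<^bsub>R\<^esub> \<beta> (v \<otimes>\<^bsub>H\<^esub> g) l
        = \<beta> u h \<otimes>\<^bsub>R\<^esub> sweedler R K k (\<lambda>l1 l2. \<beta> v l1 \<otimes>\<^bsub>R\<^esub> \<beta> g l2) l"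
      using assms by (simp add: HK.bracket_mult_left)
    also have "\<dots> = sweedler R K k (\<lambda>l1 l2. \<beta> u h \<otimes>\<^bsub>R\<^esub> (\<beta> v l1 \<otimes>\<^bsub>R\<^esub> \<beta> g l2)) l"
      using assms uv
      by (intro HK.K.linear_map_sweedler_eq modules bilinear_mapI linear_intros) simp_all
    \<comment> \<open>The two factors that depend on the coproduct of \<open>x\<close> are grouped
      so that they can be summed first.\<close>
    also have "\<dots> = sweedler R K k (\<lambda>l1 l2. (\<beta> u h \<otimes>\<^bsub>R\<^esub> \<beta> v l1) \<otimes>\<^bsub>R\<^esub> \<beta> g l2) l"
      using assms uv
      by (intro HK.K.sweedler_cong modules bilinear_mapI linear_intros) (simp_all add: HK.H.R.m_assoc)
    finally show "\<beta> u h \<otimes>\<^bsub>R\<^esub> \<beta> (v \<otimes>\<^bsub>H\<^esub> g) l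
        = sweedler R K k (\<lambda>l1 l2. (\<beta> u h \<otimes>\<^bsub>R\<^esub> \<beta> v l1) \<otimes>\<^bsub>R\<^esub> \<beta> g l2) l" .
  qed (use assms in \<open>intro bilinear_mapI linear_intros; simp add: modules\<close>)
  also have "\<dots> = sweedler R K k (\<lambda>l1 l2. sweedler R H k
      (\<lambda>u v. (\<beta> u h \<otimes>\<^bsub>R\<^esub> \<beta> v l1) \<otimes>\<^bsub>R\<^esub> \<beta> g l2) x) l"
    using assms
    by (intro sweedler_swap HK.K.coalgebra_axioms HK.H.coalgebra_axioms modules bilinear_mapI linear_intros)
      simp_all
  also have "\<dots> = sweedler R K k (\<lambda>l1 l2. \<beta> x (h \<otimes>\<^bsub>K\<^esub> l1) \<otimes>\<^bsub>R\<^esub> \<beta> g l2) l"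
  proof (rule HK.K.sweedler_cong[OF modules(5) _ assms(4), symmetric])
    fix l1 l2 assume l12: "l1 \<in> carrier K" "l2 \<in> carrier K"
    have "\<beta> x (h \<otimes>\<^bsub>K\<^esub> l1) \<otimes>\<^bsub>R\<^esub> \<beta> g l2
        = sweedler R H k (\<lambda>u v. \<beta> u h \<otimes>\<^bsub>R\<^esub> \<beta> v l1) x \<otimes>\<^bsub>R\<^esub> \<beta> g l2"
      using assms l12 by (simp add: HK.bracket_mult_right)
    also have "\<dots> = sweedler R H k (\<lambda>u v. (\<beta> u h \<otimes>\<^bsub>R\<^esub> \<beta> v l1) \<otimes>\<^bsub>R\<^esub> \<beta> g l2) x"
      using assms l12
      by (intro HK.H.linear_map_sweedler_eq[where f = "\<lambda>z. z \<otimes>\<^bsub>R\<^esub> \<beta> g l2"] modules bilinear_mapI linear_intros)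
        simp_all
    finally show "\<beta> x (h \<otimes>\<^bsub>K\<^esub> l1) \<otimes>\<^bsub>R\<^esub> \<beta> g l2
        = sweedler R H k (\<lambda>u v. (\<beta> u h \<otimes>\<^bsub>R\<^esub> \<beta> v l1) \<otimes>\<^bsub>R\<^esub> \<beta> g l2) x" .
  qed (use assms in \<open>intro bilinear_mapI linear_intros; simp add: modules\<close>)
  finally show ?thesis .
qed

lemma \<Phi>_corep1_left:
  assumes "c \<in> carrier C" "h \<in> carrier K" "l \<in> carrier K"
  shows "\<Phi> h l (sweedler R C T (\<lambda>c1 c2. sweedler R H T
      (\<lambda>u v. pure_tensor R H H u (v \<otimes>\<^bsub>H\<^esub> SH (\<omega> c2))) (\<omega> c1)) c)
    = \<gamma> c (sweedler R K A (\<lambda>l1 l2. \<pi> (h \<otimes>\<^bsub>K\<^esub> l1) \<otimes>\<^bsub>A\<^esub> \<pi> (SK l2)) l)"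
proof -
  have "\<Phi> h l (sweedler R C T (\<lambda>c1 c2. sweedler R H T
      (\<lambda>u v. pure_tensor R H H u (v \<otimes>\<^bsub>H\<^esub> SH (\<omega> c2))) (\<omega> c1)) c)
    = sweedler R C k (\<lambda>c1 c2. \<Phi> h l (sweedler R H T
      (\<lambda>u v. pure_tensor R H H u (v \<otimes>\<^bsub>H\<^esub> SH (\<omega> c2))) (\<omega> c1))) c"
    using assms
    by (intro CA.C.linear_map_sweedler_eq modules bilinear_mapI linear_intros \<Phi>_linear) simp_all
  also have "\<dots> = sweedler R C k (\<lambda>c1 c2. sweedler R K k
      (\<lambda>l1 l2. \<beta> (\<omega> c1) (h \<otimes>\<^bsub>K\<^esub> l1) \<otimes>\<^bsub>R\<^esub> \<beta> (SH (\<omega> c2)) l2) l) c"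
  proof (rule CA.C.sweedler_cong[OF modules(5) _ assms(1), symmetric])
    fix x y assume xy: "x \<in> carrier C" "y \<in> carrier C"
    have "\<Phi> h l (sweedler R H T (\<lambda>u v. pure_tensor R H H u (v \<otimes>\<^bsub>H\<^esub> SH (\<omega> y))) (\<omega> x))
      = sweedler R H k (\<lambda>u v. \<Phi> h l (pure_tensor R H H u (v \<otimes>\<^bsub>H\<^esub> SH (\<omega> y)))) (\<omega> x)"
      using assms xy
      by (intro HK.H.linear_map_sweedler_eq modules bilinear_mapI linear_intros \<Phi>_linear) simp_all
    also have "\<dots> = sweedler R H k (\<lambda>u v. \<beta> u h \<otimes>\<^bsub>R\<^esub> \<beta> (v \<otimes>\<^bsub>H\<^esub> SH (\<omega> y)) l) (\<omega> x)"
      using assms xy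
      by (intro HK.H.sweedler_cong[symmetric] modules bilinear_mapI linear_intros)
        (simp_all add: \<Phi>_pure_tensor)
    also have "\<dots> = sweedler R K k (\<lambda>l1 l2. \<beta> (\<omega> x) (h \<otimes>\<^bsub>K\<^esub> l1) \<otimes>\<^bsub>R\<^esub> \<beta> (SH (\<omega> y)) l2) l"
      using assms xy by (simp add: sweedler_mult_left)
    finally show "sweedler R K k (\<lambda>l1 l2. \<beta> (\<omega> x) (h \<otimes>\<^bsub>K\<^esub> l1) \<otimes>\<^bsub>R\<^esub> \<beta> (SH (\<omega> y)) l2) l
      = \<Phi> h l (sweedler R H T (\<lambda>u v. pure_tensor R H H u (v \<otimes>\<^bsub>H\<^esub> SH (\<omega> y))) (\<omega> x))" ..
  qed (use assms in \<open>intro bilinear_mapI linear_intros; simp add: modules\<close>)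
  also have "\<dots> = sweedler R K k (\<lambda>l1 l2. sweedler R C k
      (\<lambda>c1 c2. \<beta> (\<omega> c1) (h \<otimes>\<^bsub>K\<^esub> l1) \<otimes>\<^bsub>R\<^esub> \<beta> (SH (\<omega> c2)) l2) c) l"
    using assms
    by (intro sweedler_swap HK.K.coalgebra_axioms CA.C.coalgebra_axioms modules bilinear_mapI linear_intros)
      simp_all
  also have "\<dots> = sweedler R K k (\<lambda>l1 l2. \<gamma> c (\<pi> (h \<otimes>\<^bsub>K\<^esub> l1) \<otimes>\<^bsub>A\<^esub> \<pi> (SK l2))) l"
    using assms
    by (intro HK.K.sweedler_cong[symmetric] modules bilinear_mapI linear_intros)
      (simp_all add: \<gamma>_mult_antipode)
  also have "\<dots> = \<gamma> c (sweedler R K A (\<lambda>l1 l2. \<pi> (h \<otimes>\<^bsub>K\<^esub> l1) \<otimes>\<^bsub>A\<^esub> \<pi> (SK l2)) l)"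
    using assms
    by (intro HK.K.linear_map_sweedler_eq[symmetric] modules bilinear_mapI linear_intros) simp_all
  finally show ?thesis .
qed

text \<open>The map \<open>\<theta>\<close> lets one formula serve both sides of the second
  identity, one splitting in \<open>H\<close> and the other in \<open>C\<close>. The inner sum is
  left standing because it contracts to a bracket with a product in \<open>K\<close> in one case and
  in \<open>A\<close> in the other.\<close>

lemma sweedler_mult_right:
  assumes D: "coalgebra R D" "linear_map R D H \<theta>"
    and x: "x \<in> carrier D" and "g \<in> carrier H" and h: "h \<in> carrier K" and "l \<in> carrier K"
  shows "sweedler R D k (\<lambda>u v. \<beta> (g \<otimes>\<^bsub>H\<^esub> SH (\<theta> u)) h \<otimes>\<^bsub>R\<^esub> \<beta> (\<theta> v) l) x
    = sweedler R K k (\<lambda>h1 h2. \<beta> g h1 \<otimes>\<^bsub>R\<^esub> sweedler R D k (\<lambda>u v. \<beta> (\<theta> u) (SK h2) \<otimes>\<^bsub>R\<^esub> \<beta> (\<theta> v) l) x) h"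
proof -
  interpret D: coalgebra R D by (rule D(1))
  note [simp] = linear_map_closed[OF D(2)]
  note intros = bilinear_mapI linear_intros linear_map_compose[OF D(2)]
    D.linear_map_sweedler_comp D.linear_map_sweedler_param
  have "sweedler R D k (\<lambda>u v. \<beta> (g \<otimes>\<^bsub>H\<^esub> SH (\<theta> u)) h \<otimes>\<^bsub>R\<^esub> \<beta> (\<theta> v) l) x
      = sweedler R D k (\<lambda>u v. sweedler R K k
        (\<lambda>h1 h2. \<beta> g h1 \<otimes>\<^bsub>R\<^esub> (\<beta> (\<theta> u) (SK h2) \<otimes>\<^bsub>R\<^esub> \<beta> (\<theta> v) l)) h) x"
  proof (rule D.sweedler_cong[OF modules(5) _ x])
    fix u v assume uv: "u \<in> carrier D" "v \<in> carrier D"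
    then have "\<beta> (g \<otimes>\<^bsub>H\<^esub> SH (\<theta> u)) h \<otimes>\<^bsub>R\<^esub> \<beta> (\<theta> v) l
        = sweedler R K k (\<lambda>h1 h2. \<beta> g h1 \<otimes>\<^bsub>R\<^esub> \<beta> (SH (\<theta> u)) h2) h \<otimes>\<^bsub>R\<^esub> \<beta> (\<theta> v) l"
      using assms by (simp add: HK.bracket_mult_left)
    also have "\<dots> = sweedler R K k
        (\<lambda>h1 h2. (\<beta> g h1 \<otimes>\<^bsub>R\<^esub> \<beta> (SH (\<theta> u)) h2) \<otimes>\<^bsub>R\<^esub> \<beta> (\<theta> v) l) h"
      using assms uv
      by (intro HK.K.linear_map_sweedler_eq[where f = "\<lambda>z. z \<otimes>\<^bsub>R\<^esub> \<beta> (\<theta> v) l"] modules intros)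
        simp_all
    \<comment> \<open>The antipode crosses the bracket, and the factor free of \<open>u\<close> and
      \<open>v\<close> is set apart so that it can leave the sum over \<open>x\<close>.\<close>
    also have "\<dots> = sweedler R K k
        (\<lambda>h1 h2. \<beta> g h1 \<otimes>\<^bsub>R\<^esub> (\<beta> (\<theta> u) (SK h2) \<otimes>\<^bsub>R\<^esub> \<beta> (\<theta> v) l)) h"
      using assms uv
      by (intro HK.K.sweedler_cong modules intros) (simp_all add: HK.H.R.m_assoc HK.bracket_antipode)
    finally show "\<beta> (g \<otimes>\<^bsub>H\<^esub> SH (\<theta> u)) h \<otimes>\<^bsub>R\<^esub> \<beta> (\<theta> v) l
        = sweedler R K k (\<lambda>h1 h2. \<beta> g h1 \<otimes>\<^bsub>R\<^esub> (\<beta> (\<theta> u) (SK h2) \<otimes>\<^bsub>R\<^esub> \<beta> (\<theta> v) l)) h" .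
  qed (use assms in \<open>intro intros; simp\<close>)
  also have "\<dots> = sweedler R K k (\<lambda>h1 h2. sweedler R D k
      (\<lambda>u v. \<beta> g h1 \<otimes>\<^bsub>R\<^esub> (\<beta> (\<theta> u) (SK h2) \<otimes>\<^bsub>R\<^esub> \<beta> (\<theta> v) l)) x) h"
    using assms
    by (intro sweedler_swap HK.K.coalgebra_axioms D modules intros) simp_all
  also have "\<dots> = sweedler R K k (\<lambda>h1 h2. \<beta> g h1 \<otimes>\<^bsub>R\<^esub> sweedler R D k
      (\<lambda>u v. \<beta> (\<theta> u) (SK h2) \<otimes>\<^bsub>R\<^esub> \<beta> (\<theta> v) l) x) h"
  proof (rule HK.K.sweedler_cong[OF modules(5) _ h])
    fix h1 h2 assume h12: "h1 \<in> carrier K" "h2 \<in> carrier K"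
    then show "sweedler R D k (\<lambda>u v. \<beta> g h1 \<otimes>\<^bsub>R\<^esub> (\<beta> (\<theta> u) (SK h2) \<otimes>\<^bsub>R\<^esub> \<beta> (\<theta> v) l)) x
        = \<beta> g h1 \<otimes>\<^bsub>R\<^esub> sweedler R D k (\<lambda>u v. \<beta> (\<theta> u) (SK h2) \<otimes>\<^bsub>R\<^esub> \<beta> (\<theta> v) l) x"
      using assms by (intro D.linear_map_sweedler_eq[symmetric] modules intros) simp_all
  qed (use assms in \<open>intro intros; simp add: modules\<close>)
  finally show ?thesis .
qed

lemma \<Phi>_corep2_left:
  assumes "c \<in> carrier C" "h \<in> carrier K" "l \<in> carrier K"
  shows "\<Phi> h l (sweedler R C T (\<lambda>c1 c2. sweedler R H T
      (\<lambda>u v. pure_tensor R H H (\<omega> c1 \<otimes>\<^bsub>H\<^esub> SH u) v) (\<omega> c2)) c)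
    = \<gamma> c (sweedler R K A (\<lambda>h1 h2. \<pi> h1 \<otimes>\<^bsub>A\<^esub> \<pi> (SK h2 \<otimes>\<^bsub>K\<^esub> l)) h)"
proof -
  have "\<Phi> h l (sweedler R C T (\<lambda>c1 c2. sweedler R H T
      (\<lambda>u v. pure_tensor R H H (\<omega> c1 \<otimes>\<^bsub>H\<^esub> SH u) v) (\<omega> c2)) c)
    = sweedler R C k (\<lambda>c1 c2. \<Phi> h l (sweedler R H T
      (\<lambda>u v. pure_tensor R H H (\<omega> c1 \<otimes>\<^bsub>H\<^esub> SH u) v) (\<omega> c2))) c"
    using assms
    by (intro CA.C.linear_map_sweedler_eq modules bilinear_mapI linear_intros \<Phi>_linear) simp_all
  also have "\<dots> = sweedler R C k (\<lambda>c1 c2. sweedler R K k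
      (\<lambda>h1 h2. \<beta> (\<omega> c1) h1 \<otimes>\<^bsub>R\<^esub> \<beta> (\<omega> c2) (SK h2 \<otimes>\<^bsub>K\<^esub> l)) h) c"
  proof (rule CA.C.sweedler_cong[OF modules(5) _ assms(1), symmetric])
    fix x y assume xy: "x \<in> carrier C" "y \<in> carrier C"
    have "\<Phi> h l (sweedler R H T (\<lambda>u v. pure_tensor R H H (\<omega> x \<otimes>\<^bsub>H\<^esub> SH u) v) (\<omega> y))
      = sweedler R H k (\<lambda>u v. \<Phi> h l (pure_tensor R H H (\<omega> x \<otimes>\<^bsub>H\<^esub> SH u) v)) (\<omega> y)"
      using assms xy
      by (intro HK.H.linear_map_sweedler_eq modules bilinear_mapI linear_intros \<Phi>_linear) simp_all
    also have "\<dots> = sweedler R H k (\<lambda>u v. \<beta> (\<omega> x \<otimes>\<^bsub>H\<^esub> SH u) h \<otimes>\<^bsub>R\<^esub> \<beta> v l) (\<omega> y)"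
      using assms xy
      by (intro HK.H.sweedler_cong[symmetric] modules bilinear_mapI linear_intros)
        (simp_all add: \<Phi>_pure_tensor)
    \<comment> \<open>Here \<open>\<theta>\<close> is the identity of \<open>H\<close>; the inner
      sum is then the bracket of \<open>\<omega> y\<close> with a product in
      \<open>K\<close>.\<close>
    also have "\<dots> = sweedler R K k (\<lambda>h1 h2. \<beta> (\<omega> x) h1 \<otimes>\<^bsub>R\<^esub>
        sweedler R H k (\<lambda>u v. \<beta> u (SK h2) \<otimes>\<^bsub>R\<^esub> \<beta> v l) (\<omega> y)) h"
      using assms xy by (intro sweedler_mult_right HK.H.coalgebra_axioms linear_map_ident) simp_all
    also have "\<dots> = sweedler R K k (\<lambda>h1 h2. \<beta> (\<omega> x) h1 \<otimes>\<^bsub>R\<^esub> \<beta> (\<omega> y) (SK h2 \<otimes>\<^bsub>K\<^esub> l)) h"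
      using assms xy
      by (intro HK.K.sweedler_cong[symmetric] modules bilinear_mapI linear_intros)
        (simp_all, simp_all add: HK.bracket_mult_right)
    finally show "sweedler R K k (\<lambda>h1 h2. \<beta> (\<omega> x) h1 \<otimes>\<^bsub>R\<^esub> \<beta> (\<omega> y) (SK h2 \<otimes>\<^bsub>K\<^esub> l)) h
      = \<Phi> h l (sweedler R H T (\<lambda>u v. pure_tensor R H H (\<omega> x \<otimes>\<^bsub>H\<^esub> SH u) v) (\<omega> y))" ..
  qed (use assms in \<open>intro bilinear_mapI linear_intros; simp add: modules\<close>)
  also have "\<dots> = sweedler R K k (\<lambda>h1 h2. sweedler R C k
      (\<lambda>c1 c2. \<beta> (\<omega> c1) h1 \<otimes>\<^bsub>R\<^esub> \<beta> (\<omega> c2) (SK h2 \<otimes>\<^bsub>K\<^esub> l)) c) h"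
    using assms
    by (intro sweedler_swap HK.K.coalgebra_axioms CA.C.coalgebra_axioms modules bilinear_mapI linear_intros)
      simp_all
  also have "\<dots> = sweedler R K k (\<lambda>h1 h2. \<gamma> c (\<pi> h1 \<otimes>\<^bsub>A\<^esub> \<pi> (SK h2 \<otimes>\<^bsub>K\<^esub> l))) h"
    using assms
    by (intro HK.K.sweedler_cong[symmetric] modules bilinear_mapI linear_intros)
      (simp_all add: \<gamma>_mult)
  also have "\<dots> = \<gamma> c (sweedler R K A (\<lambda>h1 h2. \<pi> h1 \<otimes>\<^bsub>A\<^esub> \<pi> (SK h2 \<otimes>\<^bsub>K\<^esub> l)) h)"
    using assms
    by (intro HK.K.linear_map_sweedler_eq[symmetric] modules bilinear_mapI linear_intros) simp_all
  finally show ?thesis .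
qed

text \<open>Unlike in the first identity, the multiplied legs \<open>c1\<close> and
  \<open>c2\<close> come from different splits, so the inner sum is not a convolution. The product
  in \<open>H\<close> is unfolded into a sum over \<open>h\<close> instead, and the regrouping takes
  place in \<open>A\<close>.\<close>

lemma \<Phi>_corep2_right:
  assumes "c \<in> carrier C" "h \<in> carrier K" "l \<in> carrier K"
  shows "\<Phi> h l (sweedler3 R C T (\<lambda>c1 c2 c3. pure_tensor R H H (\<omega> c1 \<otimes>\<^bsub>H\<^esub> SH (\<omega> c2)) (\<omega> c3)) c)
    = \<gamma> c (sweedler R K A (\<lambda>h1 h2. \<pi> h1 \<otimes>\<^bsub>A\<^esub> \<pi> (SK h2) \<otimes>\<^bsub>A\<^esub> \<pi> l) h)"
proof -
  have "\<Phi> h l (sweedler3 R C T (\<lambda>c1 c2 c3. pure_tensor R H H (\<omega> c1 \<otimes>\<^bsub>H\<^esub> SH (\<omega> c2)) (\<omega> c3)) c)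
    = sweedler R C k (\<lambda>c1 w. \<Phi> h l (sweedler R C T
      (\<lambda>y z. pure_tensor R H H (\<omega> c1 \<otimes>\<^bsub>H\<^esub> SH (\<omega> y)) (\<omega> z)) w)) c"
    unfolding sweedler3_def using assms
    by (intro CA.C.linear_map_sweedler_eq modules bilinear_mapI linear_intros \<Phi>_linear) simp_all
  also have "\<dots> = sweedler R C k (\<lambda>c1 w. sweedler R K k
      (\<lambda>h1 h2. \<gamma> c1 (\<pi> h1) \<otimes>\<^bsub>R\<^esub> \<gamma> w (\<pi> (SK h2) \<otimes>\<^bsub>A\<^esub> \<pi> l)) h) c"
  proof (rule CA.C.sweedler_cong[OF modules(5) _ assms(1), symmetric])
    fix x w assume xw: "x \<in> carrier C" "w \<in> carrier C"
    have "\<Phi> h l (sweedler R C T (\<lambda>y z. pure_tensor R H H (\<omega> x \<otimes>\<^bsub>H\<^esub> SH (\<omega> y)) (\<omega> z)) w)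
      = sweedler R C k (\<lambda>y z. \<Phi> h l (pure_tensor R H H (\<omega> x \<otimes>\<^bsub>H\<^esub> SH (\<omega> y)) (\<omega> z))) w"
      using assms xw
      by (intro CA.C.linear_map_sweedler_eq modules bilinear_mapI linear_intros \<Phi>_linear) simp_all
    also have "\<dots> = sweedler R C k (\<lambda>y z. \<beta> (\<omega> x \<otimes>\<^bsub>H\<^esub> SH (\<omega> y)) h \<otimes>\<^bsub>R\<^esub> \<beta> (\<omega> z) l) w"
      using assms xw
      by (intro CA.C.sweedler_cong[symmetric] modules bilinear_mapI linear_intros)
        (simp_all add: \<Phi>_pure_tensor)
    \<comment> \<open>Now \<open>\<theta>\<close> is \<open>\<omega>\<close>, and the inner sum is
      the bracket of \<open>w\<close> with a product in \<open>A\<close>.\<close>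
    also have "\<dots> = sweedler R K k (\<lambda>h1 h2. \<beta> (\<omega> x) h1 \<otimes>\<^bsub>R\<^esub>
        sweedler R C k (\<lambda>y z. \<beta> (\<omega> y) (SK h2) \<otimes>\<^bsub>R\<^esub> \<beta> (\<omega> z) l) w) h"
      using assms xw by (intro sweedler_mult_right CA.C.coalgebra_axioms \<omega>_linear) simp_all
    also have "\<dots> = sweedler R K k (\<lambda>h1 h2. \<gamma> x (\<pi> h1) \<otimes>\<^bsub>R\<^esub> \<gamma> w (\<pi> (SK h2) \<otimes>\<^bsub>A\<^esub> \<pi> l)) h"
      using assms xw
      by (intro HK.K.sweedler_cong[symmetric] modules bilinear_mapI linear_intros)
        (simp_all, simp_all add: \<gamma>_mult adjoint)
    finally show "sweedler R K k (\<lambda>h1 h2. \<gamma> x (\<pi> h1) \<otimes>\<^bsub>R\<^esub> \<gamma> w (\<pi> (SK h2) \<otimes>\<^bsub>A\<^esub> \<pi> l)) h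
      = \<Phi> h l (sweedler R C T (\<lambda>y z. pure_tensor R H H (\<omega> x \<otimes>\<^bsub>H\<^esub> SH (\<omega> y)) (\<omega> z)) w)" ..
  qed (use assms in \<open>intro bilinear_mapI linear_intros; simp add: modules\<close>)
  also have "\<dots> = sweedler R K k (\<lambda>h1 h2. sweedler R C k
      (\<lambda>c1 w. \<gamma> c1 (\<pi> h1) \<otimes>\<^bsub>R\<^esub> \<gamma> w (\<pi> (SK h2) \<otimes>\<^bsub>A\<^esub> \<pi> l)) c) h"
    using assms
    by (intro sweedler_swap HK.K.coalgebra_axioms CA.C.coalgebra_axioms modules bilinear_mapI linear_intros)
      simp_all
  \<comment> \<open>Associativity of \<open>A\<close> groups the last two factors together, matching
    the leg \<open>w\<close> that was split a second time.\<close>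
  also have "\<dots> = sweedler R K k (\<lambda>h1 h2. \<gamma> c (\<pi> h1 \<otimes>\<^bsub>A\<^esub> \<pi> (SK h2) \<otimes>\<^bsub>A\<^esub> \<pi> l)) h"
    using assms
    by (intro HK.K.sweedler_cong[symmetric] modules bilinear_mapI linear_intros)
      (simp_all add: CA.bracket_mult_right CA.A.m_assoc)
  also have "\<dots> = \<gamma> c (sweedler R K A (\<lambda>h1 h2. \<pi> h1 \<otimes>\<^bsub>A\<^esub> \<pi> (SK h2) \<otimes>\<^bsub>A\<^esub> \<pi> l) h)"
    using assms
    by (intro HK.K.linear_map_sweedler_eq[symmetric] modules bilinear_mapI linear_intros) simp_all
  finally show ?thesis .
qed

section \<open>Cancellation by non-degeneracy and the two implications\<close>

lemma \<gamma>_eqI: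
  assumes "right_nondegenerate R C A p" "a \<in> carrier A" "b \<in> carrier A"
    and eq: "\<And>c. c \<in> carrier C \<Longrightarrow> \<gamma> c a = \<gamma> c b"
  shows "a = b"
proof -
  have "\<gamma> c (a \<ominus>\<^bsub>A\<^esub> b) = \<zero>\<^bsub>R\<^esub>" if c: "c \<in> carrier C" for c
  proof -
    have "\<gamma> c (a \<ominus>\<^bsub>A\<^esub> b) = \<gamma> c a \<ominus>\<^bsub>k\<^esub> \<gamma> c b"
      using linear_map_minus[OF modules(4,5) bilinear_map_right[OF bilinear_map_bracket[OF CA.pairing] c] assms(2,3)] .
    then show ?thesis
      using eq[OF c] c assms(2,3) by (simp add: a_minus_def HK.H.R.r_neg)
  qed
  moreover have "a \<ominus>\<^bsub>A\<^esub> b \<in> carrier A"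
    using assms(2,3) by simp
  ultimately have "a \<ominus>\<^bsub>A\<^esub> b = \<zero>\<^bsub>A\<^esub>"
    using assms(1) unfolding right_nondegenerate_def by blast
  then show ?thesis
    using assms(2,3) by (rule CA.A.eq_if_minus_eq_zero)
qed

lemma tensor_eqI:
  assumes "field R" "left_nondegenerate R H K q" "s \<in> carrier T" "t \<in> carrier T"
    and eq: "\<And>h l. \<lbrakk>h \<in> carrier K; l \<in> carrier K\<rbrakk> \<Longrightarrow> \<Phi> h l s = \<Phi> h l t"
  shows "s = t"
proof -
  interpret T: module R T by (rule modules)
  have "s \<ominus>\<^bsub>T\<^esub> t = \<zero>\<^bsub>T\<^esub>"
  \<comment> \<open>The same pairing and the same left non-degeneracy serve both tensor
    factors.\<close>
  proof (rule tensor_brackets_zero_imp_zero[OF assms(1) HK.pairing assms(2) HK.pairing assms(2)])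
    show "s \<ominus>\<^bsub>T\<^esub> t \<in> carrier T"
      using assms by simp
    show "tensor_lift R H H k (\<lambda>u v. \<beta> u h \<otimes>\<^bsub>R\<^esub> \<beta> v l) (s \<ominus>\<^bsub>T\<^esub> t) = \<zero>\<^bsub>R\<^esub>"
      if "h \<in> carrier K" "l \<in> carrier K" for h l
      using linear_map_minus[OF modules(6,5) \<Phi>_linear[OF that] assms(3,4)]
        linear_map_closed[OF \<Phi>_linear[OF that] assms(4)] eq[OF that]
      by (simp add: \<Phi>_def a_minus_def HK.H.R.r_neg)
  qed
  then show ?thesis
    using assms(3,4) by (rule T.eq_if_minus_eq_zero)
qed

lemma partial_representation_if_partial_corepresentation:
  assumes "right_nondegenerate R C A p" "partial_corepresentation R C H \<omega>"
  shows "partial_representation R K A \<pi>"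
proof -
  note corep = assms(2)[unfolded partial_corepresentation_def]
  note eqI = \<gamma>_eqI[OF assms(1)]
  have "\<pi> \<one>\<^bsub>K\<^esub> = \<one>\<^bsub>A\<^esub>"
  proof (rule eqI)
    \<comment> \<open>Brackets with units are counits, so the counit condition on
      \<open>\<omega>\<close> is the unit condition on \<open>\<pi>\<close> tested against
      \<open>c\<close>.\<close>
    show "\<gamma> c (\<pi> \<one>\<^bsub>K\<^esub>) = \<gamma> c \<one>\<^bsub>A\<^esub>" if "c \<in> carrier C" for c
      using that corep by (simp add: adjoint HK.bracket_one_right CA.bracket_one_right)
  qed simp_all
  moreover have "sweedler R K A (\<lambda>l1 l2. \<pi> h \<otimes>\<^bsub>A\<^esub> \<pi> l1 \<otimes>\<^bsub>A\<^esub> \<pi> (SK l2)) l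
      = sweedler R K A (\<lambda>l1 l2. \<pi> (h \<otimes>\<^bsub>K\<^esub> l1) \<otimes>\<^bsub>A\<^esub> \<pi> (SK l2)) l"
    if hl: "h \<in> carrier K" "l \<in> carrier K" for h l
  proof (rule eqI)
    \<comment> \<open>Read backwards, the evaluation formulas turn both brackets into values of
      \<open>\<Phi> h l\<close> on the two sides of the first corepresentation identity at
      \<open>c\<close>.\<close>
    show "\<gamma> c (sweedler R K A (\<lambda>l1 l2. \<pi> h \<otimes>\<^bsub>A\<^esub> \<pi> l1 \<otimes>\<^bsub>A\<^esub> \<pi> (SK l2)) l)
        = \<gamma> c (sweedler R K A (\<lambda>l1 l2. \<pi> (h \<otimes>\<^bsub>K\<^esub> l1) \<otimes>\<^bsub>A\<^esub> \<pi> (SK l2)) l)" if "c \<in> carrier C" for c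
      using that hl corep by (simp flip: \<Phi>_corep1_right \<Phi>_corep1_left)
  qed (use hl in \<open>intro HK.K.sweedler_closed modules bilinear_mapI linear_intros; simp\<close>)+
  moreover have "sweedler R K A (\<lambda>h1 h2. \<pi> h1 \<otimes>\<^bsub>A\<^esub> \<pi> (SK h2) \<otimes>\<^bsub>A\<^esub> \<pi> l) h
      = sweedler R K A (\<lambda>h1 h2. \<pi> h1 \<otimes>\<^bsub>A\<^esub> \<pi> (SK h2 \<otimes>\<^bsub>K\<^esub> l)) h"
    if hl: "h \<in> carrier K" "l \<in> carrier K" for h l
  proof (rule eqI)
    show "\<gamma> c (sweedler R K A (\<lambda>h1 h2. \<pi> h1 \<otimes>\<^bsub>A\<^esub> \<pi> (SK h2) \<otimes>\<^bsub>A\<^esub> \<pi> l) h)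
        = \<gamma> c (sweedler R K A (\<lambda>h1 h2. \<pi> h1 \<otimes>\<^bsub>A\<^esub> \<pi> (SK h2 \<otimes>\<^bsub>K\<^esub> l)) h)" if "c \<in> carrier C" for c
      using that hl corep by (simp flip: \<Phi>_corep2_right \<Phi>_corep2_left)
  qed (use hl in \<open>intro HK.K.sweedler_closed modules bilinear_mapI linear_intros; simp\<close>)+
  ultimately show ?thesis
    using \<pi>_linear by (simp add: partial_representation_def)
qed

lemma partial_corepresentation_if_partial_representation:
  assumes "field R" "left_nondegenerate R H K q" "partial_representation R K A \<pi>"
  shows "partial_corepresentation R C H \<omega>"
proof -
  note rep = assms(3)[unfolded partial_representation_def]
  note eqI = tensor_eqI[OF assms(1,2)]
  have "counit H (\<omega> c) = counit C c" if "c \<in> carrier C" for c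
  proof -
    \<comment> \<open>The counit of \<open>H\<close> is the bracket with the unit of
      \<open>K\<close>, which adjunction moves to \<open>\<pi>\<close>; the unit condition on
      \<open>\<pi>\<close> then gives the counit of \<open>C\<close>.\<close>
    have "counit H (\<omega> c) = \<gamma> c (\<pi> \<one>\<^bsub>K\<^esub>)"
      using that by (simp add: adjoint HK.bracket_one_right)
    then show ?thesis
      using that rep by (simp add: CA.bracket_one_right)
  qed
  moreover have "sweedler R C T (\<lambda>c1 c2. sweedler R H T
        (\<lambda>u v. pure_tensor R H H u (v \<otimes>\<^bsub>H\<^esub> SH (\<omega> c2))) (\<omega> c1)) c
      = sweedler3 R C T (\<lambda>c1 c2 c3. pure_tensor R H H (\<omega> c1) (\<omega> c2 \<otimes>\<^bsub>H\<^esub> SH (\<omega> c3))) c"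
    if c: "c \<in> carrier C" for c
  proof (rule eqI)
    show "\<Phi> h l (sweedler R C T (\<lambda>c1 c2. sweedler R H T
          (\<lambda>u v. pure_tensor R H H u (v \<otimes>\<^bsub>H\<^esub> SH (\<omega> c2))) (\<omega> c1)) c)
        = \<Phi> h l (sweedler3 R C T (\<lambda>c1 c2 c3. pure_tensor R H H (\<omega> c1) (\<omega> c2 \<otimes>\<^bsub>H\<^esub> SH (\<omega> c3))) c)"
      if "h \<in> carrier K" "l \<in> carrier K" for h l
      using that c rep by (simp add: \<Phi>_corep1_right \<Phi>_corep1_left)
  qed (unfold sweedler3_def, (use c in \<open>intro CA.C.sweedler_closed modules bilinear_mapI linear_intros; simp\<close>)+)
  moreover have "sweedler R C T (\<lambda>c1 c2. sweedler R H T
        (\<lambda>u v. pure_tensor R H H (\<omega> c1 \<otimes>\<^bsub>H\<^esub> SH u) v) (\<omega> c2)) c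
      = sweedler3 R C T (\<lambda>c1 c2 c3. pure_tensor R H H (\<omega> c1 \<otimes>\<^bsub>H\<^esub> SH (\<omega> c2)) (\<omega> c3)) c"
    if c: "c \<in> carrier C" for c
  proof (rule eqI)
    show "\<Phi> h l (sweedler R C T (\<lambda>c1 c2. sweedler R H T
          (\<lambda>u v. pure_tensor R H H (\<omega> c1 \<otimes>\<^bsub>H\<^esub> SH u) v) (\<omega> c2)) c)
        = \<Phi> h l (sweedler3 R C T (\<lambda>c1 c2 c3. pure_tensor R H H (\<omega> c1 \<otimes>\<^bsub>H\<^esub> SH (\<omega> c2)) (\<omega> c3)) c)"
      if "h \<in> carrier K" "l \<in> carrier K" for h l
      using that c rep by (simp add: \<Phi>_corep2_right \<Phi>_corep2_left)
  qed (unfold sweedler3_def, (use c in \<open>intro CA.C.sweedler_closed modules bilinear_mapI linear_intros; simp\<close>)+)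
  ultimately show ?thesis
    using \<omega>_linear by (simp add: partial_corepresentation_def)
qed

end

theorem proposition4p12:
  fixes R :: "('k, 'r) ring_scheme"
    and H :: "('k, 'h, 'x) hopf_scheme" and K :: "('k, 'l, 'y) hopf_scheme"
    and C :: "('k, 'c, 'u) coalg_scheme" and A :: "('k, 'a, 'v) module_scheme"
    and q :: "('h \<times> 'l \<Rightarrow> 'k) set \<Rightarrow> 'k" and p :: "('c \<times> 'a \<Rightarrow> 'k) set \<Rightarrow> 'k"
    and \<omega> :: "'c \<Rightarrow> 'h" and \<pi> :: "'l \<Rightarrow> 'a"
  assumes "cring R"
    and "hopf_pairing R H K q"
    and "coalgebra_algebra_pairing R C A p"
    and "pairing_morphism R C A p H K q \<omega> \<pi>"
  shows "(right_nondegenerate R C A p \<and> partial_corepresentation R C H \<omega>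
           \<longrightarrow> partial_representation R K A \<pi>)
       \<and> (field R \<and> left_nondegenerate R H K q \<and> partial_representation R K A \<pi>
           \<longrightarrow> partial_corepresentation R C H \<omega>)"
proof -
  interpret pairing_of_maps R H K C A q p \<omega> \<pi>
    using assms(2-4) by (intro pairing_of_maps.intro pairing_of_maps_axioms.intro)
  show ?thesis
    using partial_representation_if_partial_corepresentation
      partial_corepresentation_if_partial_representation by blast
qed

end
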